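(* Let $N=\{1,\dots,n\}$ be a finite set of players. The LRM solution $R_{\mathrm{LRM}}:\mathcal{SG}^N\to\mathcal{T}^N$ is the unique solution $R:\mathcal{SG}^N\to\mathcal{T}^N$ that satisfies the three properties Desirable Monotonicity (DM), Anonymity of Minimal Winning Coalitions (AMWC) and Independence of Larger Minimal Winning Coalitions (ILMWC).
   Context: A simple game on $N=\{1,\dots,n\}$ is a function $v:2^N\to\{0,1\}$ with $v(\varnothing)=0$, $v(N)=1$ and $v(S)\le v(T)$ whenever $S\subseteq T\subseteq N$; $\mathcal{SG}^N$ is the set of simple games on $N$. A coalition $S\subseteq N$ is winning if $v(S)=1$; $\mathcal{W}^v$ is the set of winning coalitions and $\mathcal{W}^v_{\min}$ is the set of inclusion-minimal elements of $\mathcal{W}^v$. $\mathcal{T}^N$ is the set of total preorders (reflexive, transitive, total binary relations) on $N$. A (ranking) solution is a map $R:\mathcal{SG}^N\to\mathcal{T}^N$, $v\mapsto R^v$; $I^v$ and $P^v$ denote the symmetric and asymmetric parts of $R^v$. LRM solution: for $i\in N$ and $k\in\{1,\dots,n\}$ let $i_k=|\{S\in\mathcal{W}^v_{\min}: i\in S, |S|=k\}|$ and $\theta_v(i)=(i_1,\dots,i_n)$. For real vectors, $\mathbf{x}\ge_L\mathbf{y}$ means that either $\mathbf{x}=\mathbf{y}$ or there is $k$ with $x_t=y_t$ for $t=1,\dots,k-1$ and $x_k>y_k$. The Lexicographic Ranking based on Minimal winning coalitions (LRM) $R_{\mathrm{LRM}}$ is defined by: $i\,R_{\mathrm{LRM}}^v\,j$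 iff $\theta_v(i)\ge_L\theta_v(j)$. Desirability relation: $i\succeq^v j$ iff for all $S\subseteq N\setminus\{i,j\}$, $S\cup\{j\}\in\mathcal{W}^v$ implies $S\cup\{i\}\in\mathcal{W}^v$. $i\sim^v j$ means $i\succeq^v j$ and $j\succeq^v i$. $i\succ^v j$ means $i\succeq^v j$ and there exists $T\subseteq N\setminus\{i,j\}$ with $T\cup\{i\}\in\mathcal{W}^v$ and $T\cup\{j\}\notin\mathcal{W}^v$. DM: for all $i,j\in N$ and $v\in\mathcal{SG}^N$, $i\sim^v j\Rightarrow i\,I^v j$ and $i\succ^v j\Rightarrow i\,P^v j$. AMWC: for all $i,j\in N$, all $v,v_\pi\in\mathcal{SG}^N$ and every bijection $\pi$ of $2^{N\setminus\{i,j\}}$ onto itself with $|\pi(S)|=|S|$ for all $S$, such that for all $S\in 2^{N\setminus\{i,j\}}$: $S\cup\{i\}\in\mathcal{W}^v_{\min}\Leftrightarrow S\cup\{i\}\in\mathcal{W}^{v_\pi}_{\min}$ and $S\cup\{j\}\in\mathcal{W}^v_{\min}\Leftrightarrow \pi(S)\cup\{j\}\in\mathcal{W}^{v_\pi}_{\min}$, one has $i\,R^v j\Leftrightarrow i\,R^{v_\pi} j$. ILMWC: for all $i,j\in N$ and $v\in\mathcal{SG}^N$, let $h=\max\{|S|: S\in\mathcal{W}^v_{\min},\ S\cap\{i,j\}\ne\varnothing\}$. For every collection $\mathcal{S}_h=\{S_1,\dots,S_r\}$ of coalitions $S_k\subseteq N$ with $|S_k|>h$ for all $k$ and such that for no $k$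 is there a $Q\in\mathcal{W}^v_{\min}\cup\mathcal{S}_h$ with $Q\subsetneq S_k$, and every simple game $v'\in\mathcal{SG}^N$ with $\mathcal{W}^{v'}_{\min}=\mathcal{W}^v_{\min}\cup\mathcal{S}_h$, one has $i\,P^v j\Rightarrow i\,P^{v'} j$. *)

theory Defs
  imports Main "HOL-Library.FuncSet"
begin

abbreviation players :: "nat \<Rightarrow> nat set" where
  "players n \<equiv> {1..n}"

text \<open>Functions with a restricted domain (games on \<open>2^N\<close>, solutions on the set of simple games)
  are extensional functions, so that equality of solutions means agreement on all simple games.\<close>

definition simple_games :: "nat \<Rightarrow> (nat set \<Rightarrow> nat) set" where
  "simple_games n =
     {v \<in> Pow (players n) \<rightarrow>\<^sub>E {0, 1}.
        v {} = 0 \<and> v (players n) = 1 \<and> mono_on (Pow (players n)) v}"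

definition winning :: "nat \<Rightarrow> (nat set \<Rightarrow> nat) \<Rightarrow> nat set set" where
  "winning n v = {S. S \<subseteq> players n \<and> v S = 1}"

definition min_winning :: "nat \<Rightarrow> (nat set \<Rightarrow> nat) \<Rightarrow> nat set set" where
  "min_winning n v = {S \<in> winning n v. \<not> (\<exists>T \<in> winning n v. T \<subset> S)}"

definition total_preorders :: "nat \<Rightarrow> nat rel set" where
  "total_preorders n = {r. preorder_on (players n) r \<and> total_on (players n) r}"

type_synonym solution = "(nat set \<Rightarrow> nat) \<Rightarrow> nat rel"

definition solutions :: "nat \<Rightarrow> solution set" where
  "solutions n = simple_games n \<rightarrow>\<^sub>E total_preorders n"

definition sym_part :: "nat rel \<Rightarrow> nat rel" where
  "sym_part r = {(i, j). (i, j) \<in> r \<and> (j, i) \<in> r}"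

definition asym_part :: "nat rel \<Rightarrow> nat rel" where
  "asym_part r = {(i, j). (i, j) \<in> r \<and> (j, i) \<notin> r}"

text \<open>A vector \<open>(x\<^sub>1, \<dots>, x\<^sub>n)\<close> is a function on \<open>nat\<close> of which only the values at \<open>1, \<dots>, n\<close>
  are used.\<close>

definition lex_ge :: "nat \<Rightarrow> (nat \<Rightarrow> 'a::linorder) \<Rightarrow> (nat \<Rightarrow> 'a) \<Rightarrow> bool" where
  "lex_ge n x y \<longleftrightarrow>
     (\<forall>t \<in> {1..n}. x t = y t) \<or>
     (\<exists>k \<in> {1..n}. (\<forall>t \<in> {1..<k}. x t = y t) \<and> x k > y k)"

definition theta :: "nat \<Rightarrow> (nat set \<Rightarrow> nat) \<Rightarrow> nat \<Rightarrow> nat \<Rightarrow> nat" where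
  "theta n v i k = card {S \<in> min_winning n v. i \<in> S \<and> card S = k}"

definition LRM :: "nat \<Rightarrow> solution" where
  "LRM n = (\<lambda>v \<in> simple_games n.
     {(i, j). i \<in> players n \<and> j \<in> players n \<and> lex_ge n (theta n v i) (theta n v j)})"

definition desirable :: "nat \<Rightarrow> (nat set \<Rightarrow> nat) \<Rightarrow> nat \<Rightarrow> nat \<Rightarrow> bool" where
  "desirable n v i j \<longleftrightarrow>
     (\<forall>S. S \<subseteq> players n - {i, j} \<longrightarrow> S \<union> {j} \<in> winning n v \<longrightarrow> S \<union> {i} \<in> winning n v)"

definition equally_desirable :: "nat \<Rightarrow> (nat set \<Rightarrow> nat) \<Rightarrow> nat \<Rightarrow> nat \<Rightarrow> bool" where
  "equally_desirable n v i j \<longleftrightarrow> desirable n v i j \<and> desirable n v j i"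

definition strictly_desirable :: "nat \<Rightarrow> (nat set \<Rightarrow> nat) \<Rightarrow> nat \<Rightarrow> nat \<Rightarrow> bool" where
  "strictly_desirable n v i j \<longleftrightarrow> desirable n v i j \<and>
     (\<exists>T. T \<subseteq> players n - {i, j} \<and> T \<union> {i} \<in> winning n v \<and> T \<union> {j} \<notin> winning n v)"

definition DM :: "nat \<Rightarrow> solution \<Rightarrow> bool" where
  "DM n R \<longleftrightarrow>
     (\<forall>i \<in> players n. \<forall>j \<in> players n. \<forall>v \<in> simple_games n.
        (equally_desirable n v i j \<longrightarrow> (i, j) \<in> sym_part (R v)) \<and>
        (strictly_desirable n v i j \<longrightarrow> (i, j) \<in> asym_part (R v)))"

definition AMWC :: "nat \<Rightarrow> solution \<Rightarrow> bool" where
  "AMWC n R \<longleftrightarrow>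
     (\<forall>i \<in> players n. \<forall>j \<in> players n. \<forall>v \<in> simple_games n. \<forall>w \<in> simple_games n.
        \<forall>p. bij_betw p (Pow (players n - {i, j})) (Pow (players n - {i, j})) \<longrightarrow>
          (\<forall>S \<in> Pow (players n - {i, j}). card (p S) = card S) \<longrightarrow>
          (\<forall>S \<in> Pow (players n - {i, j}).
             (S \<union> {i} \<in> min_winning n v \<longleftrightarrow> S \<union> {i} \<in> min_winning n w) \<and>
             (S \<union> {j} \<in> min_winning n v \<longleftrightarrow> p S \<union> {j} \<in> min_winning n w)) \<longrightarrow>
          ((i, j) \<in> R v \<longleftrightarrow> (i, j) \<in> R w))"

text \<open>If neither \<open>i\<close> nor \<open>j\<close> belongs to a minimal winning coalition, the maximum over the empty
  set is taken to be \<open>0\<close>. Under \<open>DM\<close> this case is void for \<open>ILMWC\<close> below, since \<open>i\<close> and \<open>j\<close>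
  are then equally desirable.\<close>

definition max_mwc_size :: "nat \<Rightarrow> (nat set \<Rightarrow> nat) \<Rightarrow> nat \<Rightarrow> nat \<Rightarrow> nat" where
  "max_mwc_size n v i j =
     Max (insert 0 (card ` {S \<in> min_winning n v. S \<inter> {i, j} \<noteq> {}}))"

definition ILMWC :: "nat \<Rightarrow> solution \<Rightarrow> bool" where
  "ILMWC n R \<longleftrightarrow>
     (\<forall>i \<in> players n. \<forall>j \<in> players n. \<forall>v \<in> simple_games n.
        \<forall>\<S>. \<S> \<subseteq> Pow (players n) \<longrightarrow>
          (\<forall>S \<in> \<S>. card S > max_mwc_size n v i j) \<longrightarrow>
          (\<forall>S \<in> \<S>. \<not> (\<exists>Q \<in> min_winning n v \<union> \<S>. Q \<subset> S)) \<longrightarrow>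
          (\<forall>w \<in> simple_games n. min_winning n w = min_winning n v \<union> \<S> \<longrightarrow>
             (i, j) \<in> asym_part (R v) \<longrightarrow> (i, j) \<in> asym_part (R w)))"

end

theory Submission
  imports Defs
begin

text \<open>Fix players \<open>i, j\<close> and let \<open>A\<close>, \<open>B\<close> be the antichains on \<open>N - {i, j}\<close> obtained from the minimal winning
  coalitions containing only \<open>i\<close>, respectively only \<open>j\<close>. LRM compares the level sizes of \<open>A\<close> and \<open>B\<close>
  lexicographically, and AMWC says that whether \<open>i R j\<close> holds depends only on \<open>A\<close> and the level
  sizes of \<open>B\<close>. If no level of \<open>B\<close> is larger than that of \<open>A\<close>, then \<open>B\<close> can be moved inside \<open>A\<close>, and DM
  gives \<open>i R j\<close>. By ILMWC it remains to exclude \<open>j R i\<close> when the level sizes agree below a top level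
  \<open>k\<close>, where \<open>A\<close> is larger. This is harder, since now \<open>B\<close> is fixed, and \<open>A\<close> may be replaced only by
  an antichain with the same level sizes, so that it need not be possible to make \<open>A\<close> contain \<open>B\<close>.

  One argues by induction on the number of sets of \<open>B\<close> below level \<open>k\<close>. Compressions, as in the
  proof of the Kruskal-Katona theorem, replace \<open>A\<close> by an antichain which is split at a third
  player \<open>l\<close>: its sets containing \<open>l\<close> are no larger than its sets not containing \<open>l\<close>. This leaves
  room for a game with the same \<open>A\<close> and \<open>B\<close> in which \<open>l R j\<close>, while the pair \<open>i, l\<close> falls under the
  induction hypothesis, so that not \<open>l R i\<close>; transitivity excludes \<open>j R i\<close>.\<close>

subsection \<open>Levels of set families\<close>

definition level_card :: "'a set set \<Rightarrow> nat \<Rightarrow> nat" where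
  "level_card F k = card {S \<in> F. card S = k}"

definition antichain :: "'a set set \<Rightarrow> bool" where
  "antichain F \<longleftrightarrow> (\<forall>S\<in>F. \<forall>T\<in>F. \<not> S \<subset> T)"

lemma antichain_subset: "antichain F \<Longrightarrow> G \<subseteq> F \<Longrightarrow> antichain G"
  unfolding antichain_def by blast

lemma antichain_eq: "antichain F \<Longrightarrow> S \<in> F \<Longrightarrow> T \<in> F \<Longrightarrow> S \<subseteq> T \<Longrightarrow> S = T"
  unfolding antichain_def by blast

lemma level_card_mono: "finite F \<Longrightarrow> G \<subseteq> F \<Longrightarrow> level_card G k \<le> level_card F k"
  unfolding level_card_def by (rule card_mono) auto

lemma level_card_union_disjoint:
  assumes "finite F" "finite G" "F \<inter> G = {}"
  shows "level_card (F \<union> G) k = level_card F k + level_card G k"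
proof -
  have "{S \<in> F \<union> G. card S = k} = {S \<in> F. card S = k} \<union> {S \<in> G. card S = k}" by blast
  then show ?thesis
    unfolding level_card_def using assms by (simp add: card_Un_disjoint disjoint_iff)
qed

lemma level_card_split:
  assumes "finite F"
  shows "level_card F k = level_card {S \<in> F. x \<notin> S} k + level_card {S \<in> F. x \<in> S} k"
proof -
  have "F = {S \<in> F. x \<notin> S} \<union> {S \<in> F. x \<in> S}" by blast
  moreover have "level_card ({S \<in> F. x \<notin> S} \<union> {S \<in> F. x \<in> S}) k =
      level_card {S \<in> F. x \<notin> S} k + level_card {S \<in> F. x \<in> S} k"
    using assms by (intro level_card_union_disjoint) auto
  ultimately show ?thesis by argo
qed

lemma level_card_image:
  assumes "inj_on f F" "\<And>S. S \<in> F \<Longrightarrow> card (f S) = card S"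
  shows "level_card (f ` F) k = level_card F k"
proof -
  have "{S \<in> f ` F. card S = k} = f ` {S \<in> F. card S = k}" using assms(2) by auto
  moreover have "inj_on f {S \<in> F. card S = k}" using assms(1) by (auto simp: inj_on_def)
  ultimately show ?thesis unfolding level_card_def by (simp add: card_image)
qed

lemma level_card_pos_iff:
  assumes "finite F"
  shows "0 < level_card F k \<longleftrightarrow> (\<exists>S\<in>F. card S = k)"
  using assms unfolding level_card_def by (auto simp: card_gt_0_iff)

text \<open>Levels are disjoint, so the sizes can be prescribed one level at a time.\<close>

lemma subset_with_level_cards:
  assumes "finite F" "\<And>k. c k \<le> level_card F k"
  obtains G where "G \<subseteq> F" "\<And>k. level_card G k = c k"
proof -
  have "\<exists>H. H \<subseteq> {S \<in> F. card S = k} \<and> card H = c k" for k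
    using obtain_subset_with_card_n[of "c k" "{S \<in> F. card S = k}"] assms(2)[of k]
    unfolding level_card_def by metis
  then obtain H where H: "\<And>k. H k \<subseteq> {S \<in> F. card S = k}" "\<And>k. card (H k) = c k"
    by metis
  have "{S \<in> (\<Union>k. H k). card S = k} = H k" for k using H(1) by fast
  then show ?thesis
    using that[of "\<Union>k. H k"] H unfolding level_card_def by fastforce
qed

text \<open>Bijections between corresponding fibres of \<open>f\<close> and \<open>g\<close> glue to
  an injective map of \<open>X\<close> into itself, which is onto because \<open>X\<close> is
  finite.\<close>

lemma bij_betw_respecting:
  assumes "finite X" "\<And>y. card {x \<in> X. f x = y} = card {x \<in> X. g x = y}"
  obtains p where "bij_betw p X X" "\<And>x. x \<in> X \<Longrightarrow> g (p x) = f x"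
proof -
  have "\<exists>h. bij_betw h {x \<in> X. f x = y} {x \<in> X. g x = y}" for y
    using assms by (intro finite_same_card_bij) auto
  then obtain h where h: "\<And>y. bij_betw (h y) {x \<in> X. f x = y} {x \<in> X. g x = y}" by metis
  define p where "p x = h (f x) x" for x
  have p: "p x \<in> X \<and> g (p x) = f x" if "x \<in> X" for x
    using bij_betwE[OF h[of "f x"]] that unfolding p_def by auto
  have "inj_on p X"
  proof (rule inj_onI)
    fix x y assume *: "x \<in> X" "y \<in> X" "p x = p y"
    then have "f x = f y" using p by metis
    then show "x = y"
      using bij_betw_imp_inj_on[OF h[of "f y"]] * unfolding p_def inj_on_def by auto
  qed
  moreover have "p ` X \<subseteq> X" using p by auto
  ultimately have "bij_betw p X X"
    using assms(1) by (simp add: bij_betw_def endo_inj_surj)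
  then show ?thesis using that p by blast
qed

text \<open>The fibres to be matched are those of the pair (size, membership); equal level sizes of
  \<open>F\<close> and \<open>G\<close> make the non-members agree in number too. This supplies the
  bijection that AMWC quantifies over.\<close>

lemma bij_betw_level_preserving:
  assumes "finite X" "F \<subseteq> X" "G \<subseteq> X" "\<And>k. level_card F k = level_card G k"
  obtains p where "bij_betw p X X" "\<And>S. S \<in> X \<Longrightarrow> card (p S) = card S"
    "\<And>S. S \<in> X \<Longrightarrow> p S \<in> G \<longleftrightarrow> S \<in> F"
proof -
  have "card {S \<in> X. (card S, S \<in> F) = (k, b)} = card {S \<in> X. (card S, S \<in> G) = (k, b)}" for k b
  proof -
    have *: "card {S \<in> X. card S = k \<and> S \<notin> H} = card {S \<in> X. card S = k} - level_card H k"
      if "H \<subseteq> X" for H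
    proof -
      have "{S \<in> X. card S = k \<and> S \<notin> H} = {S \<in> X. card S = k} - {S \<in> H. card S = k}" by blast
      then show ?thesis
        unfolding level_card_def using that assms(1)
        by (simp add: card_Diff_subset finite_subset subset_iff)
    qed
    have "{S \<in> X. card S = k \<and> S \<in> H} = {S \<in> H. card S = k}" if "H \<subseteq> X" for H
      using that by blast
    then show ?thesis
      using * assms(2-4) by (cases b) (simp_all add: level_card_def)
  qed
  then have "card {S \<in> X. (card S, S \<in> F) = y} = card {S \<in> X. (card S, S \<in> G) = y}" for y
    by (cases y) blast
  from bij_betw_respecting[OF assms(1) this] obtain p where
    "bij_betw p X X" "\<And>S. S \<in> X \<Longrightarrow> (card (p S), p S \<in> G) = (card S, S \<in> F)" by blast
  then show ?thesis using that by auto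
qed

subsection \<open>Shadows and compressions\<close>

text \<open>Up-sets are expressed below by \<open>upper_shadow X G \<subseteq> G\<close>; the
  minimal members of such a \<open>G\<close> are then those in
  \<open>G - upper_shadow X G\<close>.\<close>

definition upper_shadow :: "'a set \<Rightarrow> 'a set set \<Rightarrow> 'a set set" where
  "upper_shadow X G = {insert x S | x S. S \<in> G \<and> x \<in> X - S}"

text \<open>\<open>V\<close> is taken out and \<open>U\<close> put in, as in the UV-compressions of
  extremal set theory; movability makes the swap reversible.\<close>

definition uv_swap :: "'a set \<Rightarrow> 'a set \<Rightarrow> 'a set \<Rightarrow> 'a set" where
  "uv_swap U V S = (S - V) \<union> U"

definition movable :: "'a set \<Rightarrow> 'a set \<Rightarrow> 'a set \<Rightarrow> bool" where
  "movable U V S \<longleftrightarrow> V \<subseteq> S \<and> U \<inter> S = {}"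

definition uv_closed :: "'a set \<Rightarrow> 'a set \<Rightarrow> 'a set set \<Rightarrow> bool" where
  "uv_closed U V G \<longleftrightarrow> (\<forall>S\<in>G. movable U V S \<longrightarrow> uv_swap U V S \<in> G)"

text \<open>A movable set whose image is already in \<open>G\<close> stays where it is. This keeps
  sets from collapsing and is what preserves the level sizes.\<close>

definition compress :: "'a set \<Rightarrow> 'a set \<Rightarrow> 'a set set \<Rightarrow> 'a set set" where
  "compress U V G = (let M = {S \<in> G. movable U V S \<and> uv_swap U V S \<notin> G} in
     (G - M) \<union> uv_swap U V ` M)"

lemma uv_swap_swap: "movable U V S \<Longrightarrow> uv_swap V U (uv_swap U V S) = S"
  unfolding uv_swap_def movable_def by blast

lemma movable_swap: "movable U V S \<Longrightarrow> U \<inter> V = {} \<Longrightarrow> movable V U (uv_swap U V S)"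
  unfolding uv_swap_def movable_def by blast

lemma card_uv_swap:
  assumes "finite S" "finite U" "card U = card V" "movable U V S"
  shows "card (uv_swap U V S) = card S"
proof -
  have "V \<subseteq> S" "U \<inter> S = {}" using assms(4) by (auto simp: movable_def)
  moreover have "finite V" using calculation assms finite_subset by blast
  moreover have "card ((S - V) \<union> U) = card (S - V) + card U"
    using assms calculation by (intro card_Un_disjoint) auto
  moreover have "card (S - V) = card S - card V" "card V \<le> card S"
    using calculation assms by (auto simp: card_Diff_subset card_mono)
  ultimately show ?thesis unfolding uv_swap_def using assms(3) by simp
qed

text \<open>Since \<open>U\<close> is nonempty and disjoint from \<open>V\<close>, no set is movable
  in both directions. Each pair of swap partners is therefore decided separately: the partner
  containing \<open>U\<close> is present if either was in \<open>G\<close>, the one containing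
  \<open>V\<close> only if both were.\<close>

lemma compress_iff:
  assumes "U \<inter> V = {}" "U \<noteq> {}"
  shows "T \<in> compress U V G \<longleftrightarrow>
    (if movable U V T then T \<in> G \<and> uv_swap U V T \<in> G
     else if movable V U T then T \<in> G \<or> uv_swap V U T \<in> G else T \<in> G)"
proof -
  have excl: "\<not> (movable U V T \<and> movable V U T)"
    using assms by (auto simp: movable_def)
  have "T \<in> uv_swap U V ` {S \<in> G. movable U V S \<and> uv_swap U V S \<notin> G} \<longleftrightarrow>
      movable V U T \<and> uv_swap V U T \<in> G \<and> T \<notin> G"
  proof
    assume "T \<in> uv_swap U V ` {S \<in> G. movable U V S \<and> uv_swap U V S \<notin> G}"
    then show "movable V U T \<and> uv_swap V U T \<in> G \<and> T \<notin> G"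
      using movable_swap[OF _ assms(1)] by (auto simp: uv_swap_swap)
  next
    assume "movable V U T \<and> uv_swap V U T \<in> G \<and> T \<notin> G"
    moreover have "movable U V (uv_swap V U T)" if "movable V U T"
      using movable_swap[of V U T] that assms(1) by blast
    ultimately show "T \<in> uv_swap U V ` {S \<in> G. movable U V S \<and> uv_swap U V S \<notin> G}"
      by (intro image_eqI[of _ _ "uv_swap V U T"]) (auto simp: uv_swap_swap)
  qed
  then show ?thesis unfolding compress_def Let_def using excl by auto
qed

lemma compress_mono:
  assumes "U \<inter> V = {}" "U \<noteq> {}" "G \<subseteq> H"
  shows "compress U V G \<subseteq> compress U V H"
  using assms(3) by (auto simp: compress_iff[OF assms(1,2)] split: if_splits)

lemma compress_subset_Pow:
  assumes "G \<subseteq> Pow X" "U \<subseteq> X"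
  shows "compress U V G \<subseteq> Pow X"
  using assms unfolding compress_def uv_swap_def Let_def by auto

lemma level_card_compress:
  assumes "finite X" "G \<subseteq> Pow X" "U \<subseteq> X" "U \<inter> V = {}" "card U = card V"
  shows "level_card (compress U V G) k = level_card G k"
proof -
  define M where "M = {S \<in> G. movable U V S \<and> uv_swap U V S \<notin> G}"
  have fin: "finite G" using assms(1,2) by (meson finite_Pow_iff finite_subset)
  have finM: "finite M" unfolding M_def using fin by simp
  have "inj_on (uv_swap U V) M"
    by (rule inj_on_inverseI[of _ "uv_swap V U"]) (simp add: M_def uv_swap_swap)
  moreover have "card (uv_swap U V S) = card S" if "S \<in> M" for S
  proof (rule card_uv_swap)
    show "finite S" using that assms(1,2) by (auto simp: M_def intro: finite_subset)
    show "finite U" using assms(1,3) finite_subset by blast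
  qed (use that assms(5) in \<open>auto simp: M_def\<close>)
  ultimately have "level_card (uv_swap U V ` M) k = level_card M k"
    by (rule level_card_image)
  moreover have "level_card (compress U V G) k =
      level_card (G - M) k + level_card (uv_swap U V ` M) k"
    unfolding compress_def Let_def M_def[symmetric]
    using fin finM by (intro level_card_union_disjoint) (auto simp: M_def)
  moreover have "level_card G k = level_card (G - M) k + level_card M k"
  proof -
    have "(G - M) \<union> M = G" unfolding M_def by blast
    then show ?thesis using level_card_union_disjoint[of "G - M" M k] fin finM by auto
  qed
  ultimately show ?thesis by argo
qed

text \<open>Movability of \<open>T = insert y S\<close> decides which of \<open>T\<close> and its
  swap partner must be found in the old shadow. Usually \<open>S\<close> or its partner, with
  \<open>y\<close> added, suffices. The delicate case is \<open>y \<in> V\<close>: closedness under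
  the smaller swap of \<open>V - {y}\<close> for \<open>U - {u}\<close> then gives a member of
  \<open>G\<close> that becomes the required set when \<open>u\<close> is added.\<close>

lemma upper_shadow_compress:
  assumes UV: "U \<inter> V = {}" "U \<noteq> {}" "V \<noteq> {}" "U \<subseteq> X" "V \<subseteq> X"
    and closed: "\<And>v. v \<in> V \<Longrightarrow> \<exists>u\<in>U. uv_closed (U - {u}) (V - {v}) G"
  shows "upper_shadow X (compress U V G) \<subseteq> compress U V (upper_shadow X G)"
proof
  note ci = compress_iff[OF UV(1,2)]
  have sh: "insert x S \<in> upper_shadow X G" if "S \<in> G" "x \<in> X - S" for x S
    using that unfolding upper_shadow_def by blast
  have closedD: "\<exists>u\<in>U. (S - (V - {v})) \<union> (U - {u}) \<in> G"
    if S: "v \<in> V" "S \<in> G" "V - {v} \<subseteq> S" "U \<inter> S = {}" for v S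
  proof -
    obtain u where u: "u \<in> U" "uv_closed (U - {u}) (V - {v}) G" using closed[OF S(1)] ..
    have "movable (U - {u}) (V - {v}) S" using S unfolding movable_def by blast
    then show ?thesis using u S(2) unfolding uv_closed_def uv_swap_def by blast
  qed
  fix T assume "T \<in> upper_shadow X (compress U V G)"
  then obtain y S where T: "T = insert y S" "S \<in> compress U V G" "y \<in> X - S"
    unfolding upper_shadow_def by blast
  show "T \<in> compress U V (upper_shadow X G)"
  proof (cases "movable U V T")
    case True
    then have mT: "V \<subseteq> T" "U \<inter> T = {}" by (auto simp: movable_def)
    have "T \<in> upper_shadow X G \<and> uv_swap U V T \<in> upper_shadow X G"
    proof (cases "y \<in> V")
      case False
      then have "movable U V S" using mT T by (auto simp: movable_def)
      then have S: "S \<in> G" "uv_swap U V S \<in> G" using T(2) ci by auto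
      have "uv_swap U V T = insert y (uv_swap U V S)"
        using False T(1) unfolding uv_swap_def by blast
      moreover have "y \<in> X - uv_swap U V S" using T mT unfolding uv_swap_def by blast
      ultimately show ?thesis using sh[OF S(1)] sh[OF S(2)] T by simp
    next
      case True
      \<comment> \<open>\<open>S\<close> lacks the element \<open>y\<close> of \<open>V\<close> and
        is disjoint from the nonempty \<open>U\<close>, so compression leaves it alone.\<close>
      then have "\<not> movable U V S" "\<not> movable V U S" using mT T UV by (auto simp: movable_def)
      then have S: "S \<in> G" using T(2) ci by auto
      obtain u where u: "u \<in> U" "(S - (V - {y})) \<union> (U - {u}) \<in> G"
        using closedD[OF True S] mT T by blast
      have "uv_swap U V T = insert u ((S - (V - {y})) \<union> (U - {u}))"
        using True T u(1) mT unfolding uv_swap_def by blast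
      moreover have "u \<in> X - ((S - (V - {y})) \<union> (U - {u}))" using u(1) UV mT T by blast
      ultimately show ?thesis using sh[OF S] sh[OF u(2)] T by simp
    qed
    then show ?thesis using True ci by simp
  next
    case nm: False
    show ?thesis
    proof (cases "movable V U T")
      case True
      then have mT: "U \<subseteq> T" "V \<inter> T = {}" by (auto simp: movable_def)
      have "T \<in> upper_shadow X G \<or> uv_swap V U T \<in> upper_shadow X G"
      proof (cases "y \<in> U")
        case True
        then have "\<not> movable U V S" "\<not> movable V U S" using mT T UV by (auto simp: movable_def)
        then have "S \<in> G" using T(2) ci by auto
        then show ?thesis using sh T by blast
      next
        case False
        then have "\<not> movable U V S" "movable V U S" using mT T UV by (auto simp: movable_def)
        then consider "S \<in> G" | "uv_swap V U S \<in> G" using T(2) ci by auto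
        then show ?thesis
        proof cases
          case 2
          have "uv_swap V U T = insert y (uv_swap V U S)"
            using False T(1) unfolding uv_swap_def by blast
          moreover have "y \<in> X - uv_swap V U S" using T mT unfolding uv_swap_def by blast
          ultimately show ?thesis using sh[OF 2] by simp
        qed (use sh T in blast)
      qed
      then show ?thesis using True nm ci by simp
    next
      case False
      have "T \<in> upper_shadow X G"
      proof (cases "S \<in> G")
        case True then show ?thesis using sh T by blast
      next
        case nS: False
        \<comment> \<open>Being new, \<open>S\<close> is the image of a moved set. Since
          \<open>T\<close> contains \<open>U\<close> and yet cannot be moved back, the added
          \<open>y\<close> must lie in \<open>V\<close>.\<close>
        then have S: "movable V U S" "uv_swap V U S \<in> G" using T(2) ci by (auto split: if_splits)
        then have yV: "y \<in> V" using T(1) False by (auto simp: movable_def)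
        have mS: "U \<subseteq> S" "V \<inter> S = {}" using S by (auto simp: movable_def)
        obtain u where u: "u \<in> U" "(uv_swap V U S - (V - {y})) \<union> (U - {u}) \<in> G"
          using closedD[OF yV S(2)] UV unfolding uv_swap_def by blast
        have "T = insert u ((uv_swap V U S - (V - {y})) \<union> (U - {u}))"
          using yV mS T u(1) UV unfolding uv_swap_def by blast
        moreover have "u \<in> X - ((uv_swap V U S - (V - {y})) \<union> (U - {u}))"
          using u(1) UV unfolding uv_swap_def by blast
        ultimately show ?thesis using sh[OF u(2)] by simp
      qed
      then show ?thesis using nm False ci by simp
    qed
  qed
qed

text \<open>Adding elements one at a time stays inside \<open>G\<close>, so \<open>T\<close> with an
  element outside \<open>S\<close> removed is still in \<open>G\<close>, and \<open>T\<close> is one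
  step above it.\<close>

lemma upward_closed_imp_upper_shadow:
  assumes "finite X" "upper_shadow X G \<subseteq> G" "S \<in> G" "S \<subset> T" "T \<subseteq> X"
  shows "T \<in> upper_shadow X G"
proof -
  have up: "S \<union> D \<in> G" if "finite D" "D \<subseteq> X" for D
    using that
  proof (induction D)
    case (insert x D)
    then have "S \<union> D \<in> G" by simp
    then show ?case
      using insert.prems assms(2) unfolding upper_shadow_def
      by (cases "x \<in> S \<union> D") (auto simp: insert_absorb)
  qed (simp add: assms(3))
  obtain x where x: "x \<in> T" "x \<notin> S" using assms(4) by blast
  have "S \<union> (T - {x}) \<in> G"
    using up[of "T - {x}"] assms(1,5) by (meson Diff_subset finite_subset order_trans)
  moreover have "S \<union> (T - {x}) = T - {x}" using assms(4) x by blast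
  ultimately have "T - {x} \<in> G" by simp
  moreover have "T = insert x (T - {x})" using x by blast
  ultimately show ?thesis unfolding upper_shadow_def using x assms(5) by blast
qed

text \<open>By induction on the size of \<open>U\<close>, the family is closed under the smaller compressions that make
  \<open>upper_shadow_compress\<close> applicable; a compression that still changed \<open>G\<close> would produce more sets containing \<open>x\<close>.\<close>

lemma uv_closed_of_maximal:
  assumes X: "finite X" and G: "G \<subseteq> Pow X" "upper_shadow X G \<subseteq> G"
    and max: "\<And>H. H \<subseteq> Pow X \<Longrightarrow> upper_shadow X H \<subseteq> H \<Longrightarrow>
        (\<And>k. level_card H k = level_card G k) \<Longrightarrow>
        (\<And>k. level_card (upper_shadow X H) k \<le> level_card (upper_shadow X G) k) \<Longrightarrow>
        card {S \<in> H. x \<in> S} \<le> card {S \<in> G. x \<in> S}"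
    and UV: "U \<subseteq> X" "V \<subseteq> X" "U \<inter> V = {}" "card U = card V" "x \<in> U"
  shows "uv_closed U V G"
  using UV
proof (induction "card U" arbitrary: U V rule: less_induct)
  case less
  note UV = less.prems
  have fin: "finite U" "finite V" "finite G"
    using X UV(1,2) G(1) by (auto intro: finite_subset finite_subset[of G "Pow X"])
  have ne: "U \<noteq> {}" "V \<noteq> {}" using UV fin by auto
  have closed: "\<exists>u\<in>U. uv_closed (U - {u}) (V - {v}) G" if v: "v \<in> V" for v
  proof (cases "U = {x}")
    case True
    then have "card V = 1" using UV(4) by simp
    then have "V = {v}" using v by (metis card_1_singletonE singletonD)
    \<comment> \<open>Both remaining sets are empty, and the swap is the identity.\<close>
    then show ?thesis using True by (auto simp: uv_closed_def uv_swap_def)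
  next
    case False
    \<comment> \<open>Removing some \<open>u \<noteq> x\<close> keeps \<open>x\<close> in the
      smaller set, as the induction hypothesis requires.\<close>
    then obtain u where u: "u \<in> U" "u \<noteq> x" using UV(5) by blast
    have "uv_closed (U - {u}) (V - {v}) G"
    proof (rule less.hyps)
      show "card (U - {u}) < card U" using u fin by (intro psubset_card_mono) auto
      show "card (U - {u}) = card (V - {v})" using u v fin UV(4) by simp
    qed (use UV u in auto)
    then show ?thesis using u by blast
  qed
  let ?H = "compress U V G"
  have sh: "upper_shadow X ?H \<subseteq> compress U V (upper_shadow X G)"
    by (rule upper_shadow_compress[OF UV(3) ne UV(1,2) closed])
  have cP: "compress U V (upper_shadow X G) \<subseteq> Pow X"
    by (rule compress_subset_Pow[OF order_trans[OF G(2,1)] UV(1)])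
  show ?case
  proof (rule ccontr)
    assume nclosed: "\<not> uv_closed U V G"
    define M where "M = {S \<in> G. movable U V S \<and> uv_swap U V S \<notin> G}"
    have M: "M \<noteq> {}" "M \<subseteq> G" "finite M"
      using nclosed fin by (auto simp: M_def uv_closed_def)
    have "card {S \<in> ?H. x \<in> S} \<le> card {S \<in> G. x \<in> S}"
    proof (rule max)
      show "?H \<subseteq> Pow X" by (rule compress_subset_Pow[OF G(1) UV(1)])
      show "upper_shadow X ?H \<subseteq> ?H"
        using sh compress_mono[OF UV(3) ne(1) G(2)] by (rule order_trans)
      show "level_card ?H k = level_card G k" for k
        by (rule level_card_compress[OF X G(1) UV(1,3,4)])
      show "level_card (upper_shadow X ?H) k \<le> level_card (upper_shadow X G) k" for k
      proof -
        have "level_card (upper_shadow X ?H) k \<le> level_card (compress U V (upper_shadow X G)) k"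
          using sh cP X by (intro level_card_mono) (auto intro: finite_subset[of _ "Pow X"])
        also have "\<dots> = level_card (upper_shadow X G) k"
          by (rule level_card_compress[OF X order_trans[OF G(2,1)] UV(1,3,4)])
        finally show ?thesis .
      qed
    qed
    moreover have "{S \<in> ?H. x \<in> S} = {S \<in> G. x \<in> S} \<union> uv_swap U V ` M"
      using UV(5) unfolding compress_def Let_def M_def[symmetric]
      by (auto simp: uv_swap_def) (auto simp: M_def movable_def)
    moreover have "card ({S \<in> G. x \<in> S} \<union> uv_swap U V ` M) =
        card {S \<in> G. x \<in> S} + card (uv_swap U V ` M)"
      using fin M by (intro card_Un_disjoint) (auto simp: M_def)
    moreover have "card (uv_swap U V ` M) > 0" using M by (simp add: card_gt_0_iff)
    ultimately show False by simp
  qed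
qed

text \<open>Extremality replaces repeated compression: among the families satisfying the invariants
  \<open>P\<close>, one with the most members containing \<open>x\<close> is taken. The count is
  bounded by \<open>card (Pow X)\<close>.\<close>

lemma ex_uv_closed_family:
  assumes "finite X" "G0 \<subseteq> Pow X" "upper_shadow X G0 \<subseteq> G0"
  obtains G where "G \<subseteq> Pow X" "upper_shadow X G \<subseteq> G"
    "\<And>k. level_card G k = level_card G0 k"
    "\<And>k. level_card (upper_shadow X G) k \<le> level_card (upper_shadow X G0) k"
    "\<And>U V. U \<subseteq> X \<Longrightarrow> V \<subseteq> X \<Longrightarrow> U \<inter> V = {} \<Longrightarrow> card U = card V \<Longrightarrow> x \<in> U \<Longrightarrow> uv_closed U V G"
proof -
  define P where "P G \<longleftrightarrow> G \<subseteq> Pow X \<and> upper_shadow X G \<subseteq> G \<and>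
    (\<forall>k. level_card G k = level_card G0 k) \<and>
    (\<forall>k. level_card (upper_shadow X G) k \<le> level_card (upper_shadow X G0) k)" for G
  have "P G0" using assms unfolding P_def by simp
  moreover have "\<forall>G. P G \<longrightarrow> card {S \<in> G. x \<in> S} < Suc (card (Pow X))"
    using assms(1) unfolding P_def by (auto simp: less_Suc_eq_le intro!: card_mono)
  ultimately obtain G where G: "P G" "\<And>H. P H \<Longrightarrow> card {S \<in> H. x \<in> S} \<le> card {S \<in> G. x \<in> S}"
    using ex_has_greatest_nat[of P G0 "\<lambda>G. card {S \<in> G. x \<in> S}"] by blast
  have "uv_closed U V G"
    if "U \<subseteq> X" "V \<subseteq> X" "U \<inter> V = {}" "card U = card V" "x \<in> U" for U V
  proof (rule uv_closed_of_maximal[OF assms(1) _ _ _ that])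
    show "card {S \<in> H. x \<in> S} \<le> card {S \<in> G. x \<in> S}"
      if "H \<subseteq> Pow X" "upper_shadow X H \<subseteq> H" "\<And>k. level_card H k = level_card G k"
        "\<And>k. level_card (upper_shadow X H) k \<le> level_card (upper_shadow X G) k" for H
    proof (rule G(2))
      show "P H" using G(1) that unfolding P_def by (metis order_trans)
    qed
  qed (use G(1) in \<open>auto simp: P_def\<close>)
  then show ?thesis using that[of G] G(1) unfolding P_def by blast
qed

section \<open>Splitting an antichain at a point\<close>

text \<open>\<open>A\<close> consists of the minimal members of the up-set \<open>G0\<close> it
  generates. A compressed up-set \<open>G\<close> has the same level sizes and no larger shadow,
  hence at least as many minimal members on each level, and \<open>B\<close> is chosen among these.
  The final alternative, at the lower bound \<open>t0\<close> of the sizes, later makes an induction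
  measure drop.\<close>

lemma antichain_split:
  assumes X: "finite X" and A: "A \<subseteq> Pow X" "antichain A" and x: "x \<in> X"
    and t0: "\<And>S. S \<in> A \<Longrightarrow> t0 \<le> card S"
  obtains B s where "B \<subseteq> Pow X" "antichain B" "\<And>k. level_card B k = level_card A k"
    "\<And>S. S \<in> B \<Longrightarrow> x \<in> S \<Longrightarrow> card S \<le> s" "\<And>S. S \<in> B \<Longrightarrow> x \<notin> S \<Longrightarrow> s \<le> card S"
    "(\<forall>S\<in>B. card S = t0 \<longrightarrow> x \<in> S) \<or> (\<forall>S\<subseteq>X. card S = t0 \<longrightarrow> x \<in> S \<longrightarrow> S \<in> B)"
proof -
  define G0 where "G0 = {T. T \<subseteq> X \<and> (\<exists>S\<in>A. S \<subseteq> T)}"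
  have G0: "G0 \<subseteq> Pow X" "upper_shadow X G0 \<subseteq> G0"
    unfolding G0_def upper_shadow_def by blast+
  have min0: "A = G0 - upper_shadow X G0"
  proof
    show "G0 - upper_shadow X G0 \<subseteq> A"
    proof
      fix T assume T: "T \<in> G0 - upper_shadow X G0"
      then obtain S where S: "S \<in> A" "S \<subseteq> T" unfolding G0_def by blast
      then have "S \<in> G0" using A(1) unfolding G0_def by blast
      then have "\<not> S \<subset> T"
        using upward_closed_imp_upper_shadow[OF X G0(2)] T G0(1) by blast
      then show "T \<in> A" using S by blast
    qed
    have "T \<notin> A" if T: "T \<in> upper_shadow X G0" for T
    proof -
      obtain y R S where "T = insert y R" "y \<notin> R" "S \<in> A" "S \<subseteq> R"
        using T unfolding upper_shadow_def G0_def by blast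
      then have "S \<in> A" "S \<subset> T" by auto
      then show ?thesis using A(2) unfolding antichain_def by blast
    qed
    then show "A \<subseteq> G0 - upper_shadow X G0" using A(1) unfolding G0_def by blast
  qed
  obtain G where G: "G \<subseteq> Pow X" "upper_shadow X G \<subseteq> G"
    "\<And>k. level_card G k = level_card G0 k"
    "\<And>k. level_card (upper_shadow X G) k \<le> level_card (upper_shadow X G0) k"
    "\<And>U V. U \<subseteq> X \<Longrightarrow> V \<subseteq> X \<Longrightarrow> U \<inter> V = {} \<Longrightarrow> card U = card V \<Longrightarrow> x \<in> U \<Longrightarrow> uv_closed U V G"
    by (rule ex_uv_closed_family[OF X G0, of x]) (rule that)
  have finG: "finite H" if "H \<subseteq> Pow X" for H
    using X that by (meson finite_Pow_iff finite_subset)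
  have diff: "level_card (H - upper_shadow X H) k + level_card (upper_shadow X H) k = level_card H k"
    if "H \<subseteq> Pow X" "upper_shadow X H \<subseteq> H" for H k
  proof -
    have "(H - upper_shadow X H) \<union> upper_shadow X H = H" using that by blast
    moreover have "finite H" "finite (upper_shadow X H)" using that finG by auto
    ultimately show ?thesis
      using level_card_union_disjoint[of "H - upper_shadow X H" "upper_shadow X H" k]
      by (simp add: Int_commute)
  qed
  have "level_card A k \<le> level_card (G - upper_shadow X G) k" for k
    using diff[OF G(1,2), of k] diff[OF G0, of k] G(3,4)[of k] min0 by simp
  then obtain B where B: "B \<subseteq> G - upper_shadow X G" "\<And>k. level_card B k = level_card A k"
    using subset_with_level_cards[of "G - upper_shadow X G" "level_card A"] finG[OF G(1)] by auto
  have BX: "B \<subseteq> Pow X" using B(1) G(1) by blast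
  have anti: "antichain B"
    unfolding antichain_def
    using upward_closed_imp_upper_shadow[OF X G(2)] B(1) BX by blast
  \<comment> \<open>One swap, trading \<open>S - T\<close> for \<open>T - S\<close>, leads from
    \<open>S\<close> to \<open>T\<close>, and \<open>x\<close> lies in \<open>T - S\<close>.\<close>
  have star: "T \<in> G" if S: "S \<in> G" "x \<notin> S" and T: "T \<subseteq> X" "card T = card S" "x \<in> T" for S T
  proof -
    have fin: "finite S" "finite T" using S T G(1) X by (auto intro: finite_subset)
    have "uv_closed (T - S) (S - T) G"
    proof (rule G(5))
      show "card (T - S) = card (S - T)"
        using fin T(2) by (metis card_Diff_subset_Int Int_commute finite_Int)
    qed (use S T G(1) in auto)
    moreover have "movable (T - S) (S - T) S" "uv_swap (T - S) (S - T) S = T"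
      by (auto simp: movable_def uv_swap_def)
    ultimately show ?thesis using S(1) unfolding uv_closed_def by metis
  qed
  \<comment> \<open>The threshold is the least size of a member of \<open>G\<close> avoiding
    \<open>x\<close>; if every member contains \<open>x\<close>, the size of \<open>X\<close>
    serves.\<close>
  have "\<exists>s. (\<forall>S\<in>B. x \<in> S \<longrightarrow> card S \<le> s) \<and> (\<forall>S\<in>B. x \<notin> S \<longrightarrow> s \<le> card S)"
  proof (cases "\<exists>S\<in>G. x \<notin> S")
    case False
    then show ?thesis using BX B(1) X by (intro exI[of _ "card X"]) (auto intro: card_mono)
  next
    case True
    then obtain Z where Z: "Z \<in> G" "x \<notin> Z" "\<And>S. S \<in> G \<Longrightarrow> x \<notin> S \<Longrightarrow> card Z \<le> card S"
      using arg_min_natI[of "\<lambda>S. S \<in> G \<and> x \<notin> S" _ card]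
        arg_min_nat_le[of "\<lambda>S. S \<in> G \<and> x \<notin> S" _ card] by blast
    have finZ: "finite Z" using Z(1) G(1) X finite_subset by blast
    have "card S \<le> card Z" if S: "S \<in> B" "x \<in> S" for S
    proof (rule ccontr)
      assume less: "\<not> card S \<le> card Z"
      have finS: "finite S" using S BX X finite_subset by blast
      \<comment> \<open>By \<open>star\<close>, every set through \<open>x\<close> of size
        \<open>card Z\<close> is in \<open>G\<close>, so a larger \<open>S\<close> through
        \<open>x\<close> has a proper subset in \<open>G\<close> and is not minimal. The case
        \<open>Z = {}\<close> is separate, as no empty set goes through \<open>x\<close>; there
        \<open>Z\<close> itself is the subset.\<close>
      have "\<exists>Q\<in>G. Q \<subset> S"
      proof (cases "Z = {}")
        case True
        then show ?thesis using Z(1) S(2) by blast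
      next
        case False
        then have Z1: "0 < card Z" using finZ by (simp add: card_gt_0_iff)
        have "card Z - 1 \<le> card (S - {x})" using less S finS by simp
        then obtain Q where Q: "Q \<subseteq> S - {x}" "card Q = card Z - 1" "finite Q"
          by (rule obtain_subset_with_card_n)
        have c: "card (insert x Q) = card Z" using Q Z1 by (subst card_insert_disjoint) auto
        have "insert x Q \<subseteq> S" using Q S by blast
        moreover have "insert x Q \<noteq> S" using c less by auto
        moreover have "insert x Q \<in> G"
          using star[OF Z(1,2) _ c] \<open>insert x Q \<subseteq> S\<close> S BX by blast
        ultimately show ?thesis by blast
      qed
      then have "S \<in> upper_shadow X G"
        using upward_closed_imp_upper_shadow[OF X G(2)] S BX by blast
      then show False using S B(1) by blast
    qed
    moreover have "card Z \<le> card S" if "S \<in> B" "x \<notin> S" for S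
      using Z(3) B(1) that by blast
    ultimately show ?thesis by blast
  qed
  then obtain s where s: "\<And>S. S \<in> B \<Longrightarrow> x \<in> S \<Longrightarrow> card S \<le> s"
    "\<And>S. S \<in> B \<Longrightarrow> x \<notin> S \<Longrightarrow> s \<le> card S" by blast
  \<comment> \<open>No set of \<open>A\<close> is smaller than \<open>t0\<close>, so the shadow
    starts strictly above that level. Hence \<open>B\<close> contains all of \<open>G\<close> at
    level \<open>t0\<close>, and \<open>star\<close> becomes a statement about
    \<open>B\<close>.\<close>
  have "level_card (upper_shadow X G0) t0 = 0"
  proof -
    have "card T \<noteq> t0" if T: "T \<in> upper_shadow X G0" for T
    proof -
      obtain y R S where R: "T = insert y R" "y \<notin> R" "S \<in> A" "S \<subseteq> R"
        using T unfolding upper_shadow_def G0_def by blast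
      have "T \<subseteq> X" using T G0 by blast
      then have "finite T" using X finite_subset by blast
      then have "card S < card T" using R by (intro psubset_card_mono) auto
      then show ?thesis using t0[OF R(3)] by simp
    qed
    then have "{S \<in> upper_shadow X G0. card S = t0} = {}" by blast
    then show ?thesis unfolding level_card_def by (simp only: card.empty)
  qed
  then have "level_card A t0 = level_card G t0"
    using diff[OF G0, of t0] min0 G(3)[of t0] by simp
  then have "{S \<in> B. card S = t0} = {S \<in> G. card S = t0}"
    using B finG[OF G(1)] unfolding level_card_def by (intro card_subset_eq) auto
  then have "(\<forall>S\<in>B. card S = t0 \<longrightarrow> x \<in> S) \<or> (\<forall>S\<subseteq>X. card S = t0 \<longrightarrow> x \<in> S \<longrightarrow> S \<in> B)"
    using star by (smt (verit) mem_Collect_eq)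
  then show ?thesis using that[OF BX anti B(2) s] by blast
qed

subsection \<open>Minimal winning coalitions and a pair of players\<close>

text \<open>Removing \<open>i\<close>, respectively \<open>j\<close>, turns the minimal winning coalitions containing exactly one of
  the two players into two antichains on \<open>N - {i, j}\<close>; all the axioms depend on a pair of players
  only through these.\<close>

definition only_wins :: "nat \<Rightarrow> (nat set \<Rightarrow> nat) \<Rightarrow> nat \<Rightarrow> nat \<Rightarrow> nat set set" where
  "only_wins n v i j = {S. S \<subseteq> players n - {i, j} \<and> insert i S \<in> min_winning n v}"

lemma winning_mono:
  assumes "v \<in> simple_games n" "S \<in> winning n v" "S \<subseteq> T" "T \<subseteq> players n"
  shows "T \<in> winning n v"
proof -
  have S: "S \<subseteq> players n" "v S = 1" using assms(2) by (auto simp: winning_def)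
  then have "v S \<le> v T"
    using assms mono_onD[of "Pow (players n)" v S T] unfolding simple_games_def by simp
  moreover have "v T \<in> {0, 1}"
    using assms(1,4) unfolding simple_games_def by (auto dest: PiE_mem)
  ultimately show ?thesis using S assms(4) unfolding winning_def by auto
qed

lemma winning_imp_min_winning:
  assumes "S \<in> winning n v"
  obtains Q where "Q \<in> min_winning n v" "Q \<subseteq> S"
proof -
  have "finite (winning n v)"
    by (rule finite_subset[of _ "Pow (players n)"]) (auto simp: winning_def)
  then obtain Q where "Q \<in> winning n v" "Q \<subseteq> S" "\<forall>T\<in>winning n v. T \<subseteq> Q \<longrightarrow> Q = T"
    using finite_has_minimal2[OF _ assms] by blast
  then show ?thesis using that unfolding min_winning_def by blast
qed

lemma min_winning_imp_winning: "S \<in> min_winning n v \<Longrightarrow> S \<in> winning n v"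
  unfolding min_winning_def by blast

lemma min_winning_antichain: "antichain (min_winning n v)"
  unfolding min_winning_def antichain_def by blast

lemma min_winning_subset: "S \<in> min_winning n v \<Longrightarrow> S \<subseteq> players n"
  unfolding min_winning_def winning_def by blast

lemma finite_min_winning: "finite (min_winning n v)"
proof (rule finite_subset)
  show "min_winning n v \<subseteq> Pow (players n)" using min_winning_subset[of _ n v] by blast
qed simp

lemma only_wins_subset: "only_wins n v i j \<subseteq> Pow (players n - {i, j})"
  unfolding only_wins_def by blast

lemma finite_only_wins: "finite (only_wins n v i j)"
  by (rule finite_subset[OF only_wins_subset]) simp

lemma only_wins_antichain: "antichain (only_wins n v i j)"
  unfolding antichain_def
proof (intro ballI notI)
  fix S T assume *: "S \<in> only_wins n v i j" "T \<in> only_wins n v i j" "S \<subset> T"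
  then have "i \<notin> S" "i \<notin> T" unfolding only_wins_def by auto
  then have "insert i S \<subset> insert i T"
    using *(3) by (simp add: psubset_eq insert_ident subset_insertI2)
  moreover have "insert i S \<in> min_winning n v" "insert i T \<in> min_winning n v"
    using * unfolding only_wins_def by simp_all
  ultimately show False using min_winning_antichain unfolding antichain_def by blast
qed

section \<open>Desirability from inclusions between the two antichains\<close>

text \<open>For distinct players, a minimal winning coalition inside \<open>S \<union> {j}\<close>
  either avoids \<open>j\<close> and already lies in \<open>S\<close>, or loses \<open>j\<close> to
  become a member of the smaller family, in which case \<open>j\<close> may be traded for
  \<open>i\<close>.\<close>

lemma desirable_of_only_wins_subset:
  assumes v: "v \<in> simple_games n" and i: "i \<in> players n"
    and sub: "only_wins n v j i \<subseteq> only_wins n v i j"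
  shows "desirable n v i j"
  unfolding desirable_def
proof (intro allI impI)
  fix S assume S: "S \<subseteq> players n - {i, j}" "S \<union> {j} \<in> winning n v"
  obtain Q where Q: "Q \<in> min_winning n v" "Q \<subseteq> S \<union> {j}"
    using winning_imp_min_winning[OF S(2)] by blast
  have SN: "S \<union> {i} \<subseteq> players n" using S(1) i by blast
  show "S \<union> {i} \<in> winning n v"
  proof (cases "j \<in> Q \<and> i \<noteq> j")
    case True
    then have "insert j (Q - {j}) = Q" by blast
    then have "Q - {j} \<in> only_wins n v j i"
      using Q S(1) True unfolding only_wins_def by auto
    then have "insert i (Q - {j}) \<in> min_winning n v" using sub unfolding only_wins_def by blast
    then show ?thesis
      using Q(2) by (intro winning_mono[OF v min_winning_imp_winning _ SN]) auto
  next
    case False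
    then show ?thesis
      using Q(2) by (intro winning_mono[OF v min_winning_imp_winning[OF Q(1)] _ SN]) auto
  qed
qed

text \<open>Any \<open>X\<close> in the difference of the families is a witness. A minimal winning
  coalition inside \<open>X \<union> {j}\<close> would either be all of it, which puts
  \<open>X\<close> in the smaller family, or lie inside \<open>X\<close>, against the minimality of
  \<open>X \<union> {i}\<close>.\<close>

lemma strictly_desirable_of_only_wins_psubset:
  assumes v: "v \<in> simple_games n" and i: "i \<in> players n"
    and sub: "only_wins n v j i \<subset> only_wins n v i j"
  shows "strictly_desirable n v i j"
proof -
  obtain X where X: "X \<in> only_wins n v i j" "X \<notin> only_wins n v j i" using sub by blast
  then have Xi: "X \<subseteq> players n - {i, j}" "insert i X \<in> min_winning n v"
    unfolding only_wins_def by auto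
  have "insert j X \<notin> winning n v"
  proof
    assume "insert j X \<in> winning n v"
    then obtain Q where Q: "Q \<in> min_winning n v" "Q \<subseteq> insert j X"
      using winning_imp_min_winning by blast
    have anti: "Q' = insert i X" if "Q' \<in> min_winning n v" "Q' \<subseteq> insert i X" for Q'
      using antichain_eq[OF min_winning_antichain that(1) Xi(2) that(2)] .
    show False
    proof (cases "j \<in> Q")
      case True
      then have "insert j (Q - {j}) = Q" by blast
      then have "Q - {j} \<in> only_wins n v j i"
        using Q Xi(1) unfolding only_wins_def by auto
      moreover from this have "insert i (Q - {j}) \<in> min_winning n v"
        using sub unfolding only_wins_def by blast
      then have "insert i (Q - {j}) = insert i X" using anti Q(2) by blast
      then have "Q - {j} = X" using Xi(1) calculation unfolding only_wins_def by blast
      ultimately show False using X(2) by blast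
    next
      case False
      then have "Q \<subseteq> X" using Q(2) by blast
      then have "Q = insert i X" using anti Q(1) by blast
      then show False using \<open>Q \<subseteq> X\<close> Xi(1) by blast
    qed
  qed
  moreover have "desirable n v i j"
    using desirable_of_only_wins_subset[OF v i] sub by blast
  moreover have "insert i X \<in> winning n v" by (rule min_winning_imp_winning[OF Xi(2)])
  ultimately show ?thesis
    unfolding strictly_desirable_def using Xi(1) by (intro conjI exI[of _ X]) simp_all
qed

lemma equally_desirable_of_only_wins_eq:
  assumes "v \<in> simple_games n" "i \<in> players n" "j \<in> players n"
    "only_wins n v i j = only_wins n v j i"
  shows "equally_desirable n v i j"
  using assms desirable_of_only_wins_subset unfolding equally_desirable_def by simp

text \<open>The grand coalition is added so that the empty family, too, generates a simple game.\<close>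

definition game_of :: "nat \<Rightarrow> nat set set \<Rightarrow> nat set \<Rightarrow> nat" where
  "game_of n F = (\<lambda>S\<in>Pow (players n). if \<exists>T\<in>insert (players n) F. T \<subseteq> S then 1 else 0)"

lemma game_of_simple:
  assumes "players n \<noteq> {}" "{} \<notin> F"
  shows "game_of n F \<in> simple_games n"
proof -
  have "mono_on (Pow (players n)) (game_of n F)"
  proof (rule mono_onI)
    fix S T assume "S \<in> Pow (players n)" "T \<in> Pow (players n)" "S \<subseteq> T"
    then have ST: "S \<in> Pow (players n)" "T \<in> Pow (players n)" "S \<subseteq> T" .
    show "game_of n F S \<le> game_of n F T"
    proof (cases "\<exists>Q\<in>insert (players n) F. Q \<subseteq> S")
      case True
      then have "\<exists>Q\<in>insert (players n) F. Q \<subseteq> T" using ST(3) by blast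
      then have "game_of n F T = 1" using ST(2) unfolding game_of_def restrict_def by presburger
      moreover have "game_of n F S \<le> 1" using ST(1) unfolding game_of_def by simp
      ultimately show ?thesis by simp
    next
      case False
      then have "game_of n F S = 0" using ST(1) unfolding game_of_def restrict_def by presburger
      then show ?thesis by simp
    qed
  qed
  then show ?thesis using assms unfolding simple_games_def game_of_def by simp
qed

lemma winning_game_of:
  "S \<in> winning n (game_of n F) \<longleftrightarrow> S \<subseteq> players n \<and> (\<exists>T\<in>insert (players n) F. T \<subseteq> S)"
  unfolding winning_def game_of_def by auto

lemma min_winning_game_of:
  assumes "F \<subseteq> Pow (players n)" "antichain F" "F \<noteq> {}"
  shows "min_winning n (game_of n F) = F"
proof -
  have w: "S \<in> winning n (game_of n F) \<longleftrightarrow> S \<subseteq> players n \<and> (\<exists>T\<in>F. T \<subseteq> S)" for S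
    unfolding winning_game_of using assms(1,3) by blast
  show ?thesis
  proof
    show "min_winning n (game_of n F) \<subseteq> F"
    proof
      fix S assume S: "S \<in> min_winning n (game_of n F)"
      then obtain T where T: "T \<in> F" "T \<subseteq> S"
        using w min_winning_imp_winning by blast
      then have "T \<in> winning n (game_of n F)" using w assms(1) by blast
      then show "S \<in> F" using S T unfolding min_winning_def by blast
    qed
    show "F \<subseteq> min_winning n (game_of n F)"
    proof
      fix S assume S: "S \<in> F"
      have "\<not> T \<subset> S" if "T \<in> winning n (game_of n F)" for T
      proof -
        obtain T' where "T' \<in> F" "T' \<subseteq> T" using \<open>T \<in> winning n (game_of n F)\<close> w by blast
        then show ?thesis using S assms(2) unfolding antichain_def by blast
      qed
      moreover have "S \<in> winning n (game_of n F)" using w S assms(1) by blast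
      ultimately show "S \<in> min_winning n (game_of n F)" unfolding min_winning_def by blast
    qed
  qed
qed

lemma min_winning_game_of_proper:
  assumes "F \<subseteq> Pow (players n)" "antichain F" "S \<noteq> players n"
  shows "S \<in> min_winning n (game_of n F) \<longleftrightarrow> S \<in> F"
proof (cases "F = {}")
  case True
  then have "S \<in> min_winning n (game_of n F) \<longrightarrow> S = players n"
    unfolding min_winning_def winning_game_of by auto
  then show ?thesis using True assms(3) by blast
next
  case False
  then show ?thesis using min_winning_game_of[OF assms(1,2)] by blast
qed

text \<open>\<open>insert i S\<close> lacks \<open>j\<close> and so differs from the grand
  coalition, which makes the formula right for empty \<open>F\<close> as well.\<close>

lemma only_wins_game_of:
  assumes "F \<subseteq> Pow (players n)" "antichain F" "i \<noteq> j" "j \<in> players n"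
  shows "only_wins n (game_of n F) i j = {S. S \<subseteq> players n - {i, j} \<and> insert i S \<in> F}"
proof -
  have "insert i S \<in> min_winning n (game_of n F) \<longleftrightarrow> insert i S \<in> F"
    if "S \<subseteq> players n - {i, j}" for S
  proof (rule min_winning_game_of_proper[OF assms(1,2)])
    have "j \<notin> insert i S" using that assms(3) by blast
    then show "insert i S \<noteq> players n" using assms(4) by metis
  qed
  then show ?thesis unfolding only_wins_def by blast
qed

section \<open>Realising two given antichains by a game\<close>

lemma antichain_insert_image:
  assumes "antichain A" "\<And>S. S \<in> A \<Longrightarrow> x \<notin> S"
  shows "antichain (insert x ` A)"
proof -
  have "\<not> insert x S \<subset> insert x T" if ST: "S \<in> A" "T \<in> A" for S T
  proof
    assume less: "insert x S \<subset> insert x T"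
    have "x \<notin> S" "x \<notin> T" using assms(2) ST by auto
    then have "S \<subset> T" using less by (simp add: psubset_eq insert_ident subset_insert)
    then show False using ST assms(1) unfolding antichain_def by blast
  qed
  then show ?thesis unfolding antichain_def by blast
qed

lemma antichain_Un:
  assumes "antichain F" "antichain G" "\<And>S T. S \<in> F \<Longrightarrow> T \<in> G \<Longrightarrow> \<not> S \<subset> T \<and> \<not> T \<subset> S"
  shows "antichain (F \<union> G)"
  using assms unfolding antichain_def by blast

text \<open>Coalitions \<open>insert i S\<close> and \<open>insert j T\<close> are incomparable,
  because each has a player missing from the other. Hence the two antichains can be prescribed
  independently, as the replacement arguments require.\<close>

lemma game_with_only_wins:
  assumes i: "i \<in> players n" and j: "j \<in> players n" and ij: "i \<noteq> j"
    and A: "A \<subseteq> Pow (players n - {i, j})" "antichain A"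
    and B: "B \<subseteq> Pow (players n - {i, j})" "antichain B"
  obtains v where "v \<in> simple_games n" "only_wins n v i j = A" "only_wins n v j i = B"
proof -
  define F where "F = insert i ` A \<union> insert j ` B"
  have sub: "F \<subseteq> Pow (players n)" using i j A B unfolding F_def by auto
  have new: "i \<notin> S" "j \<notin> S" if "S \<in> A \<union> B" for S using that A(1) B(1) by auto
  have "antichain (insert i ` A)" "antichain (insert j ` B)"
    using new by (auto intro!: antichain_insert_image A(2) B(2))
  moreover have "\<not> S \<subset> T \<and> \<not> T \<subset> S" if "S \<in> insert i ` A" "T \<in> insert j ` B" for S T
    using that new ij by auto
  ultimately have anti: "antichain F" unfolding F_def by (rule antichain_Un)
  have "only_wins n (game_of n F) i j = A"
    unfolding only_wins_game_of[OF sub anti ij j]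
  proof (intro set_eqI iffI)
    fix S assume S: "S \<in> {S. S \<subseteq> players n - {i, j} \<and> insert i S \<in> F}"
    have "j \<notin> insert i S" using S ij by blast
    then have "insert i S \<notin> insert j ` B" by blast
    then obtain T where T: "T \<in> A" "insert i S = insert i T"
      using S unfolding F_def by blast
    have "i \<notin> S" using S by blast
    then have "S = T" using T new[of T] by (auto simp: insert_ident)
    then show "S \<in> A" using T by simp
  next
    fix S assume "S \<in> A"
    then show "S \<in> {S. S \<subseteq> players n - {i, j} \<and> insert i S \<in> F}"
      using A(1) unfolding F_def by blast
  qed
  moreover have "only_wins n (game_of n F) j i = B"
    unfolding only_wins_game_of[OF sub anti ij[symmetric] i]
  proof (intro set_eqI iffI)
    fix S assume S: "S \<in> {S. S \<subseteq> players n - {j, i} \<and> insert j S \<in> F}"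
    have "i \<notin> insert j S" using S ij by blast
    then have "insert j S \<notin> insert i ` A" by blast
    then obtain T where T: "T \<in> B" "insert j S = insert j T"
      using S unfolding F_def by blast
    have "j \<notin> S" using S by blast
    then have "S = T" using T new[of T] by (auto simp: insert_ident)
    then show "S \<in> B" using T by simp
  next
    fix S assume "S \<in> B"
    then show "S \<in> {S. S \<subseteq> players n - {j, i} \<and> insert j S \<in> F}"
      using B(1) unfolding F_def by blast
  qed
  moreover have "game_of n F \<in> simple_games n"
    using i by (intro game_of_simple) (auto simp: F_def)
  ultimately show ?thesis using that by blast
qed

section \<open>The LRM order in terms of level sizes\<close>

text \<open>The shift to \<open>Suc k\<close> accounts for \<open>i\<close> itself. The second
  summand counts coalitions with both players, is symmetric in \<open>i\<close> and
  \<open>j\<close>, and cancels when the two vectors are compared.\<close>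

lemma theta_eq_only_wins:
  assumes "i \<noteq> j"
  shows "theta n v i (Suc k) = level_card (only_wins n v i j) k +
    card {S \<in> min_winning n v. i \<in> S \<and> j \<in> S \<and> card S = Suc k}"
proof -
  let ?A = "{S \<in> min_winning n v. i \<in> S \<and> j \<notin> S \<and> card S = Suc k}"
  let ?C = "{S \<in> min_winning n v. i \<in> S \<and> j \<in> S \<and> card S = Suc k}"
  have "theta n v i (Suc k) = card (?A \<union> ?C)"
    unfolding theta_def by (rule arg_cong[where f = card]) blast
  also have "\<dots> = card ?A + card ?C"
    using finite_min_winning by (intro card_Un_disjoint) auto
  also have "?A = insert i ` {S \<in> only_wins n v i j. card S = k}"
  proof (intro set_eqI iffI)
    fix S assume S: "S \<in> ?A"
    then have "S \<subseteq> players n" using min_winning_subset[of S n v] by simp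
    moreover from this have "finite S" by (rule finite_subset) simp
    moreover have "insert i (S - {i}) = S" using S by blast
    ultimately have "S - {i} \<in> only_wins n v i j" "card (S - {i}) = k"
      using S by (auto simp: only_wins_def)
    moreover have "S = insert i (S - {i})" using S by blast
    ultimately show "S \<in> insert i ` {S \<in> only_wins n v i j. card S = k}" by blast
  next
    fix S assume "S \<in> insert i ` {S \<in> only_wins n v i j. card S = k}"
    then obtain T where T: "S = insert i T" "T \<in> only_wins n v i j" "card T = k" by blast
    have "T \<subseteq> players n - {i, j}" using T(2) only_wins_subset by blast
    then have "finite T" by (rule finite_subset) simp
    moreover have "i \<notin> T" "j \<notin> T" using \<open>T \<subseteq> players n - {i, j}\<close> by auto
    ultimately show "S \<in> ?A" using T assms unfolding only_wins_def by simp
  qed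
  also have "card \<dots> = level_card (only_wins n v i j) k"
    unfolding level_card_def
    by (rule card_image) (auto simp: inj_on_def only_wins_def)
  finally show ?thesis .
qed

text \<open>Members miss the player \<open>i\<close>. This lets lexicographic comparisons range over
  all natural numbers instead of a bounded range.\<close>

lemma level_card_only_wins_zero:
  assumes "i \<in> players n" "n \<le> k"
  shows "level_card (only_wins n v i j) k = 0"
proof -
  have "card S < n" if "S \<in> only_wins n v i j" for S
  proof -
    have "S \<subset> players n" using that assms(1) unfolding only_wins_def by blast
    then show ?thesis using psubset_card_mono[of "players n" S] by simp
  qed
  then have "{S \<in> only_wins n v i j. card S = k} = {}" using assms(2) by fastforce
  then show ?thesis unfolding level_card_def by (simp only: card.empty)
qed

lemma lex_ge_theta_iff:
  assumes ij: "i \<noteq> j" "i \<in> players n" "j \<in> players n"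
  shows "lex_ge n (theta n v i) (theta n v j) \<longleftrightarrow>
    (\<forall>k. level_card (only_wins n v i j) k = level_card (only_wins n v j i) k) \<or>
    (\<exists>k. (\<forall>t<k. level_card (only_wins n v i j) t = level_card (only_wins n v j i) t) \<and>
         level_card (only_wins n v i j) k > level_card (only_wins n v j i) k)"
    (is "_ \<longleftrightarrow> (\<forall>k. ?a k = ?b k) \<or> (\<exists>k. (\<forall>t<k. ?a t = ?b t) \<and> ?a k > ?b k)")
proof -
  have com: "{S \<in> min_winning n v. i \<in> S \<and> j \<in> S \<and> card S = m} =
      {S \<in> min_winning n v. j \<in> S \<and> i \<in> S \<and> card S = m}" for m by blast
  have eq: "theta n v i (Suc k) = theta n v j (Suc k) \<longleftrightarrow> ?a k = ?b k" for k
    unfolding theta_eq_only_wins[OF ij(1)] theta_eq_only_wins[OF ij(1)[symmetric]] com by simp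
  have gt: "theta n v i (Suc k) > theta n v j (Suc k) \<longleftrightarrow> ?a k > ?b k" for k
    unfolding theta_eq_only_wins[OF ij(1)] theta_eq_only_wins[OF ij(1)[symmetric]] com by simp
  have zero: "?a k = 0" "?b k = 0" if "n \<le> k" for k
    using that level_card_only_wins_zero ij by auto
  have lt_n: "k < n" if "?a k > ?b k" for k
    using zero[of k] that by (cases "k < n") auto
  have all_Suc: "(\<forall>t\<in>{1..<Suc k}. P t) \<longleftrightarrow> (\<forall>t<k. P (Suc t))" for P k
  proof -
    have "{1..<Suc k} = Suc ` {..<k}"
      by (simp add: lessThan_atLeast0)
    then show ?thesis by auto
  qed
  have "(\<forall>t\<in>{1..n}. theta n v i t = theta n v j t) \<longleftrightarrow> (\<forall>k<n. ?a k = ?b k)"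
    using all_Suc[of n "\<lambda>t. theta n v i t = theta n v j t"] eq
    by (simp add: atLeastLessThanSuc_atLeastAtMost)
  also have "\<dots> \<longleftrightarrow> (\<forall>k. ?a k = ?b k)" using zero by (metis not_less)
  finally have 1: "(\<forall>t\<in>{1..n}. theta n v i t = theta n v j t) \<longleftrightarrow> (\<forall>k. ?a k = ?b k)" .
  have "{1..n} = Suc ` {..<n}"
    by (simp add: image_Suc_lessThan)
  then have "(\<exists>k\<in>{1..n}. (\<forall>t\<in>{1..<k}. theta n v i t = theta n v j t) \<and> theta n v i k > theta n v j k)
      \<longleftrightarrow> (\<exists>k<n. (\<forall>t<k. ?a t = ?b t) \<and> ?a k > ?b k)"
    using all_Suc[of _ "\<lambda>t. theta n v i t = theta n v j t"] eq gt by (simp add: Bex_def)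
  also have "\<dots> \<longleftrightarrow> (\<exists>k. (\<forall>t<k. ?a t = ?b t) \<and> ?a k > ?b k)"
    using lt_n by blast
  finally show ?thesis unfolding lex_ge_def 1 by (rule arg_cong)
qed

section \<open>Splitting with a set avoiding the point on the top level\<close>

text \<open>If every top-level set of the split antichain contains \<open>x\<close>, then the
  threshold is at least \<open>k\<close>, so all members contain \<open>x\<close>. One top-level set
  can then be exchanged for a set of the same size avoiding \<open>x\<close>, with \<open>k\<close>
  as the new threshold.\<close>

lemma antichain_split_top:
  assumes X: "finite X" and A: "A \<subseteq> Pow X" "antichain A" and x: "x \<in> X"
    and t0: "\<And>S. S \<in> A \<Longrightarrow> t0 \<le> card S" "\<exists>S\<in>A. card S = t0" "t0 < k"
    and k: "\<And>S. S \<in> A \<Longrightarrow> card S \<le> k" "\<exists>S\<in>A. card S = k"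
  obtains B s where "B \<subseteq> Pow X" "antichain B" "\<And>m. level_card B m = level_card A m"
    "\<And>S. S \<in> B \<Longrightarrow> x \<in> S \<Longrightarrow> card S \<le> s" "\<And>S. S \<in> B \<Longrightarrow> x \<notin> S \<Longrightarrow> s \<le> card S"
    "(\<forall>S\<in>B. card S = t0 \<longrightarrow> x \<in> S) \<or> (\<forall>S\<subseteq>X. card S = t0 \<longrightarrow> x \<in> S \<longrightarrow> S \<in> B)"
    "\<exists>S\<in>B. card S = k \<and> x \<notin> S"
proof -
  obtain B s where B: "B \<subseteq> Pow X" "antichain B" "\<And>m. level_card B m = level_card A m"
    and s: "\<And>S. S \<in> B \<Longrightarrow> x \<in> S \<Longrightarrow> card S \<le> s" "\<And>S. S \<in> B \<Longrightarrow> x \<notin> S \<Longrightarrow> s \<le> card S"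
    and star: "(\<forall>S\<in>B. card S = t0 \<longrightarrow> x \<in> S) \<or> (\<forall>S\<subseteq>X. card S = t0 \<longrightarrow> x \<in> S \<longrightarrow> S \<in> B)"
    by (rule antichain_split[OF X A x t0(1)]) (assumption, rule that)
  show ?thesis
  proof (cases "\<exists>S\<in>B. card S = k \<and> x \<notin> S")
    case True
    then show ?thesis using that[OF B s star] by blast
  next
    case False
    have fin: "finite A" "finite B" using A(1) B(1) X by (auto intro: finite_subset[of _ "Pow X"])
    have lev: "(\<exists>S\<in>B. card S = m) \<longleftrightarrow> (\<exists>S\<in>A. card S = m)" for m
      using level_card_pos_iff[OF fin(1), of m] level_card_pos_iff[OF fin(2), of m] B(3)[of m] by simp
    obtain T where T: "T \<in> B" "card T = k" using k(2) lev by blast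
    then have xT: "x \<in> T" using False by blast
    obtain T0 where T0: "T0 \<in> B" "card T0 = t0" using t0(2) lev by blast
    have le: "card S \<le> k" if "S \<in> B" for S using lev[of "card S"] k(1) that by metis
    have xB: "x \<in> S" if S: "S \<in> B" for S
    proof (rule ccontr)
      assume "x \<notin> S"
      then have "card S = k" using s(1)[OF T(1) xT] s(2)[OF S] le[OF S] T(2) by simp
      then show False using False S \<open>x \<notin> S\<close> by blast
    qed
    \<comment> \<open>\<open>T\<close> cannot be all of \<open>X\<close>, since it would contain the
      smaller member \<open>T0\<close>. So \<open>X - {x}\<close> has at least \<open>k\<close>
      elements to choose from.\<close>
    have "T \<subset> X"
    proof -
      have "T0 \<noteq> T" using T0(2) T(2) t0(3) by blast
      then have "\<not> T0 \<subseteq> T" using antichain_eq[OF B(2) T0(1) T(1)] by blast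
      then show ?thesis using T0(1) T(1) B(1) by blast
    qed
    then have "k \<le> card (X - {x})"
      using psubset_card_mono[OF X, of T] T(2) x X by simp
    then obtain Y where Y: "Y \<subseteq> X - {x}" "card Y = k" by (metis obtain_subset_with_card_n)
    define C where "C = insert Y (B - {T})"
    have YB: "Y \<notin> B" using xB Y(1) by blast
    have C: "C \<subseteq> Pow X" using B(1) Y(1) unfolding C_def by blast
    \<comment> \<open>No member is larger than \<open>Y\<close>, and every old member contains
      \<open>x\<close> while \<open>Y\<close> does not.\<close>
    have "antichain C"
    proof -
      have "\<not> Y \<subset> S" if "S \<in> B" for S
      proof
        assume "Y \<subset> S"
        moreover have "finite S" using that B(1) X finite_subset by blast
        ultimately have "card Y < card S" by (simp add: psubset_card_mono)
        then show False using le[OF that] Y(2) by simp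
      qed
      moreover have "\<not> S \<subset> Y" if "S \<in> B" for S using xB[OF that] Y(1) by blast
      ultimately show ?thesis using B(2) unfolding C_def antichain_def by blast
    qed
    moreover have "level_card C m = level_card A m" for m
    proof -
      have "level_card C m = level_card {Y} m + level_card (B - {T}) m"
        using level_card_union_disjoint[of "{Y}" "B - {T}" m] fin YB unfolding C_def by simp
      also have "level_card {Y} m = level_card {T} m"
        using T(2) Y(2) level_card_image[of "\<lambda>_. Y" "{T}" m] by simp
      also have "level_card {T} m + level_card (B - {T}) m = level_card B m"
        using level_card_union_disjoint[of "{T}" "B - {T}" m] fin T(1) by (simp add: insert_absorb)
      finally show ?thesis using B(3) by simp
    qed
    moreover have "card S \<le> k" if "S \<in> C" for S using that le Y(2) unfolding C_def by blast
    moreover have "k \<le> card S" if "S \<in> C" "x \<notin> S" for S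
      using that xB Y(2) unfolding C_def by blast
    moreover have "\<forall>S\<in>C. card S = t0 \<longrightarrow> x \<in> S"
      using xB Y(2) t0(3) unfolding C_def by blast
    moreover have "\<exists>S\<in>C. card S = k \<and> x \<notin> S" using Y unfolding C_def by blast
    ultimately show ?thesis using that[OF C, of k] by blast
  qed
qed

section \<open>A game mediating between three players\<close>

text \<open>Exchanging \<open>l\<close> for \<open>j\<close> is injective and keeps sizes on sets
  that contain \<open>l\<close> but not \<open>j\<close>; the images contain \<open>j\<close> and
  are thus not in \<open>P\<close>.\<close>

lemma level_card_relabel:
  assumes "finite P" "finite Q" "j \<notin> \<Union>P" "j \<notin> \<Union>Q" "\<And>S. S \<in> Q \<Longrightarrow> l \<in> S" "\<And>S. S \<in> Q \<Longrightarrow> finite S"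
  shows "level_card (P \<union> (\<lambda>S. insert j (S - {l})) ` Q) k = level_card P k + level_card Q k"
proof -
  let ?f = "\<lambda>S. insert j (S - {l})"
  have "inj_on ?f Q"
  proof (rule inj_onI)
    fix S T assume ST: "S \<in> Q" "T \<in> Q" "?f S = ?f T"
    then have "j \<notin> S - {l}" "j \<notin> T - {l}" using assms(4) by auto
    then have "S - {l} = T - {l}" using ST(3) by (simp add: insert_ident)
    then show "S = T" using assms(5)[OF ST(1)] assms(5)[OF ST(2)] by blast
  qed
  moreover have "card (?f S) = card S" if "S \<in> Q" for S
  proof -
    have "j \<notin> S - {l}" "finite S" "l \<in> S" using assms(4-6) that by auto
    then show ?thesis by (metis card.remove card_insert_disjoint finite_Diff)
  qed
  ultimately have "level_card (?f ` Q) k = level_card Q k" by (rule level_card_image)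
  moreover have "P \<inter> ?f ` Q = {}" using assms(3) by auto
  ultimately show ?thesis using level_card_union_disjoint[of P "?f ` Q" k] assms(1,2) by simp
qed

lemma relabel_image_iff:
  assumes "\<And>T. T \<in> Q \<Longrightarrow> l \<in> T \<and> x \<notin> T" "x \<noteq> l"
  shows "(x \<in> S \<and> l \<notin> S \<and> insert l (S - {x}) \<in> Q) \<longleftrightarrow> S \<in> (\<lambda>T. insert x (T - {l})) ` Q"
proof
  assume S: "x \<in> S \<and> l \<notin> S \<and> insert l (S - {x}) \<in> Q"
  then have "S = insert x (insert l (S - {x}) - {l})" using assms(2) by blast
  then show "S \<in> (\<lambda>T. insert x (T - {l})) ` Q" using S by blast
next
  assume "S \<in> (\<lambda>T. insert x (T - {l})) ` Q"
  then obtain T where T: "T \<in> Q" "S = insert x (T - {l})" by blast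
  then have "insert l (S - {x}) = T" using assms by auto
  then show "x \<in> S \<and> l \<notin> S \<and> insert l (S - {x}) \<in> Q" using T assms(2) by auto
qed

text \<open>\<open>A\<close> and \<open>B\<close> fix the coalitions containing exactly one of
  \<open>i\<close> and \<open>j\<close>. Free to choose are those with neither, taken from
  \<open>D\<close> with \<open>l\<close> added, and those with both, taken from \<open>L\<close>
  with \<open>l\<close> replaced by \<open>i\<close> and \<open>j\<close>. The threshold
  \<open>s\<close> excludes inclusions between these and the coalitions from \<open>A\<close>; for
  those from \<open>B\<close> it suffices that \<open>D\<close> and \<open>L\<close> are parts of
  the antichain \<open>B\<close>.\<close>

lemma mediating_game:
  assumes N: "i \<in> players n" "j \<in> players n" "l \<in> players n" and dist: "i \<noteq> j" "l \<noteq> i" "l \<noteq> j"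
    and A: "A \<subseteq> Pow (players n - {i, j})" "antichain A"
    and B: "B \<subseteq> Pow (players n - {i, j})" "antichain B"
    and s: "\<And>S. S \<in> A \<Longrightarrow> l \<in> S \<Longrightarrow> card S \<le> s" "\<And>S. S \<in> A \<Longrightarrow> l \<notin> S \<Longrightarrow> s \<le> card S"
    and D: "D \<subseteq> {S \<in> B. l \<notin> S}" "\<And>S. S \<in> D \<Longrightarrow> s \<le> card S"
    and L: "L \<subseteq> {S \<in> B. l \<in> S}" "\<And>S. S \<in> L \<Longrightarrow> card S \<le> s"
  obtains w where "w \<in> simple_games n" "only_wins n w i j = A" "only_wins n w j i = B"
    "only_wins n w i l = {S \<in> A. l \<notin> S} \<union> (\<lambda>S. insert j (S - {l})) ` L"
    "only_wins n w l i = D \<union> (\<lambda>S. insert j (S - {l})) ` {S \<in> B. l \<in> S}"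
    "only_wins n w l j = D \<union> (\<lambda>S. insert i (S - {l})) ` {S \<in> A. l \<in> S}"
    "only_wins n w j l = {S \<in> B. l \<notin> S} \<union> (\<lambda>S. insert i (S - {l})) ` L"
proof -
  define F where "F = {S. S \<subseteq> players n \<and>
    (i \<in> S \<and> j \<notin> S \<and> S - {i} \<in> A \<or>
     i \<notin> S \<and> j \<in> S \<and> S - {j} \<in> B \<or>
     i \<notin> S \<and> j \<notin> S \<and> l \<in> S \<and> S - {l} \<in> D \<or>
     i \<in> S \<and> j \<in> S \<and> l \<notin> S \<and> insert l (S - {i, j}) \<in> L)}"
  have AB: "finite S" "i \<notin> S" "j \<notin> S" "S \<subseteq> players n" if "S \<in> A \<or> S \<in> B" for S
  proof -
    have "S \<subseteq> players n - {i, j}" using that A(1) B(1) by blast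
    moreover from this have "finite S" by (rule finite_subset) simp
    ultimately show "finite S" "i \<notin> S" "j \<notin> S" "S \<subseteq> players n" by auto
  qed
  have DB: "S \<in> B" "l \<notin> S" if "S \<in> D" for S using that D(1) by auto
  have LB: "S \<in> B" "l \<in> S" if "S \<in> L" for S using that L(1) by auto
  have sub: "F \<subseteq> Pow (players n)" unfolding F_def by blast
  have antiA: False if "S \<in> A" "T \<in> A" "S \<subset> T" for S T
    using that A(2) unfolding antichain_def by blast
  have antiB: False if "S \<in> B" "T \<in> B" "S \<subset> T" for S T
    using that B(2) unfolding antichain_def by blast
  have anti: "antichain F"
    unfolding antichain_def
  proof (intro ballI notI)
    fix S T assume ST: "S \<in> F" "T \<in> F" "S \<subset> T"
    consider (i) "i \<in> S" "j \<notin> S" "S - {i} \<in> A" | (j) "i \<notin> S" "j \<in> S" "S - {j} \<in> B" |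
      (l) "i \<notin> S" "j \<notin> S" "l \<in> S" "S - {l} \<in> D" |
      (ij) "i \<in> S" "j \<in> S" "l \<notin> S" "insert l (S - {i, j}) \<in> L"
      using ST(1) unfolding F_def by blast
    then show False
    proof cases
      case i
      then consider "j \<notin> T" "T - {i} \<in> A" | "j \<in> T" "l \<notin> T" "insert l (T - {i, j}) \<in> L"
        using ST unfolding F_def by blast
      then show False
      proof cases
        case 1
        moreover have "S - {i} \<subset> T - {i}" using i ST(3) by blast
        ultimately show False using antiA i(3) by blast
      next
        case 2
        have fin: "finite (T - {i, j})" using AB(1) LB(1)[OF 2(3)] by fastforce
        \<comment> \<open>\<open>S - {i}\<close> is a member of \<open>A\<close> avoiding
          \<open>l\<close>, so it has at least \<open>s\<close> elements, while
          \<open>T - {i, j}\<close> is a member of \<open>L\<close> without its element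
          \<open>l\<close> and has fewer.\<close>
        have "s \<le> card (S - {i})" using s(2)[OF i(3)] ST(3) 2(2) by blast
        also have "\<dots> \<le> card (T - {i, j})" using fin ST(3) i(2) by (intro card_mono) auto
        also have "\<dots> < card (insert l (T - {i, j}))" using fin 2(2) by simp
        also have "\<dots> \<le> s" by (rule L(2)[OF 2(3)])
        finally show False by simp
      qed
    next
      case j
      then consider "i \<notin> T" "T - {j} \<in> B" | "i \<in> T" "l \<notin> T" "insert l (T - {i, j}) \<in> L"
        using ST unfolding F_def by blast
      then show False
      proof cases
        case 1
        moreover have "S - {j} \<subset> T - {j}" using j ST(3) by blast
        ultimately show False using antiB j(3) by blast
      next
        case 2
        have "S - {j} \<subset> insert l (T - {i, j})" using j ST(3) 2(2) by blast
        then show False using antiB[OF j(3) LB(1)[OF 2(3)]] by blast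
      qed
    next
      case l
      then consider "i \<in> T" "j \<notin> T" "T - {i} \<in> A" | "i \<notin> T" "j \<in> T" "T - {j} \<in> B" |
        "i \<notin> T" "j \<notin> T" "l \<in> T" "T - {l} \<in> D"
        using ST unfolding F_def by blast
      then show False
      proof cases
        case 1
        have fin: "finite (T - {i})" using AB(1) 1(3) by blast
        \<comment> \<open>The inclusion is strict because \<open>l\<close> is dropped on the left
          only. A member of \<open>D\<close> has at least \<open>s\<close> elements, a member of
          \<open>A\<close> through \<open>l\<close> at most \<open>s\<close>.\<close>
        have "S - {l} \<subset> T - {i}" using l ST(3) dist by blast
        then have "card (S - {l}) < card (T - {i})" by (rule psubset_card_mono[OF fin])
        also have "\<dots> \<le> s" using s(1)[OF 1(3)] l(3) ST(3) dist by blast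
        also have "\<dots> \<le> card (S - {l})" by (rule D(2)[OF l(4)])
        finally show False by simp
      next
        case 2
        have "S - {l} \<subset> T - {j}" using l ST(3) dist by blast
        then show False using antiB[OF DB(1)[OF l(4)] 2(3)] by blast
      next
        case 3
        have "S - {l} \<subset> T - {l}" using l ST(3) by blast
        then show False using antiB[OF DB(1)[OF l(4)] DB(1)[OF 3(4)]] by blast
      qed
    next
      case ij
      then have T: "i \<in> T" "j \<in> T" "l \<notin> T" "insert l (T - {i, j}) \<in> L"
        using ST unfolding F_def by blast+
      obtain y where y: "y \<in> T" "y \<notin> S" using ST(3) by blast
      then have "y \<noteq> i" "y \<noteq> j" "y \<noteq> l" using ij T by auto
      then have "y \<in> insert l (T - {i, j})" "y \<notin> insert l (S - {i, j})" using y by auto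
      moreover have "insert l (S - {i, j}) \<subseteq> insert l (T - {i, j})" using ST(3) by blast
      ultimately have "insert l (S - {i, j}) \<subset> insert l (T - {i, j})" by blast
      then show False using antiB[OF LB(1)[OF ij(4)] LB(1)[OF T(4)]] by blast
    qed
  qed
  note ow = only_wins_game_of[OF sub anti]
  have "only_wins n (game_of n F) i j = A"
  proof -
    have "S \<subseteq> players n - {i, j} \<and> insert i S \<in> F \<longleftrightarrow> S \<in> A" for S
    proof (cases "S \<subseteq> players n - {i, j}")
      case True
      then have "insert i S - {i} = S" "j \<notin> insert i S" "insert i S \<subseteq> players n"
        using dist N by auto
      then show ?thesis using True unfolding F_def by auto
    qed (use A(1) in blast)
    then show ?thesis unfolding ow[OF dist(1) N(2)] by blast
  qed
  moreover have "only_wins n (game_of n F) j i = B"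
  proof -
    have "S \<subseteq> players n - {j, i} \<and> insert j S \<in> F \<longleftrightarrow> S \<in> B" for S
    proof (cases "S \<subseteq> players n - {j, i}")
      case True
      then have "insert j S - {j} = S" "i \<notin> insert j S" "insert j S \<subseteq> players n"
        using dist N by auto
      then show ?thesis using True unfolding F_def by auto
    qed (use B(1) in blast)
    then show ?thesis unfolding ow[OF dist(1)[symmetric] N(1)] by blast
  qed
  \<comment> \<open>A coalition of \<open>F\<close> with \<open>i\<close> but without
    \<open>l\<close> either comes from a set of \<open>A\<close> avoiding \<open>l\<close>, or
    contains \<open>j\<close> as well and comes from \<open>L\<close>. The three remaining families
    are sorted in the same way.\<close>
  moreover have "only_wins n (game_of n F) i l = {S \<in> A. l \<notin> S} \<union> (\<lambda>S. insert j (S - {l})) ` L"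
  proof -
    have "S \<subseteq> players n - {i, l} \<and> insert i S \<in> F \<longleftrightarrow>
        (S \<in> A \<and> l \<notin> S) \<or> (j \<in> S \<and> l \<notin> S \<and> insert l (S - {j}) \<in> L)" for S
    proof (cases "S \<subseteq> players n - {i, l}")
      case True
      then have *: "insert i S - {i} = S" "insert i S - {i, j} = S - {j}" "l \<notin> insert i S"
          "j \<in> insert i S \<longleftrightarrow> j \<in> S" "insert i S \<subseteq> players n" "l \<notin> S"
        using dist N by auto
      then show ?thesis using True AB(3) unfolding F_def by auto
    next
      case False
      have "S \<subseteq> players n - {i, l}" if "j \<in> S" "l \<notin> S" "insert l (S - {j}) \<in> L"
        using AB(2,4)[of "insert l (S - {j})"] LB(1)[OF that(3)] that N dist by auto
      then show ?thesis using False AB(2,4)[of S] by blast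
    qed
    moreover have "(j \<in> S \<and> l \<notin> S \<and> insert l (S - {j}) \<in> L) \<longleftrightarrow>
        S \<in> (\<lambda>S. insert j (S - {l})) ` L" for S
      using relabel_image_iff[of L l j S] LB AB dist by blast
    ultimately show ?thesis unfolding ow[OF dist(2)[symmetric] N(3)] by auto
  qed
  moreover have "only_wins n (game_of n F) l i = D \<union> (\<lambda>S. insert j (S - {l})) ` {S \<in> B. l \<in> S}"
  proof -
    have "S \<subseteq> players n - {l, i} \<and> insert l S \<in> F \<longleftrightarrow>
        S \<in> D \<or> (j \<in> S \<and> l \<notin> S \<and> insert l (S - {j}) \<in> B)" for S
    proof (cases "S \<subseteq> players n - {l, i}")
      case True
      then have *: "insert l S - {l} = S" "insert l S - {j} = insert l (S - {j})" "l \<in> insert l S"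
          "j \<in> insert l S \<longleftrightarrow> j \<in> S" "i \<notin> insert l S" "insert l S \<subseteq> players n" "l \<notin> S"
        using dist N by auto
      then show ?thesis using True AB(3) DB(1) unfolding F_def by auto
    next
      case False
      have "S \<subseteq> players n - {l, i}" if "j \<in> S" "l \<notin> S" "insert l (S - {j}) \<in> B"
        using AB(2,4)[of "insert l (S - {j})"] that N dist by auto
      then show ?thesis using False AB(2,4)[of S] DB[of S] by blast
    qed
    moreover have "(j \<in> S \<and> l \<notin> S \<and> insert l (S - {j}) \<in> B) \<longleftrightarrow>
        S \<in> (\<lambda>S. insert j (S - {l})) ` {S \<in> B. l \<in> S}" for S
      using relabel_image_iff[of "{S \<in> B. l \<in> S}" l j S] AB dist by blast
    ultimately show ?thesis unfolding ow[OF dist(2) N(1)] by auto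
  qed
  moreover have "only_wins n (game_of n F) l j = D \<union> (\<lambda>S. insert i (S - {l})) ` {S \<in> A. l \<in> S}"
  proof -
    have "S \<subseteq> players n - {l, j} \<and> insert l S \<in> F \<longleftrightarrow>
        S \<in> D \<or> (i \<in> S \<and> l \<notin> S \<and> insert l (S - {i}) \<in> A)" for S
    proof (cases "S \<subseteq> players n - {l, j}")
      case True
      then have *: "insert l S - {l} = S" "insert l S - {i} = insert l (S - {i})" "l \<in> insert l S"
          "i \<in> insert l S \<longleftrightarrow> i \<in> S" "j \<notin> insert l S" "insert l S \<subseteq> players n" "l \<notin> S"
        using dist N by auto
      then show ?thesis using True AB(2) DB(1) unfolding F_def by auto
    next
      case False
      have "S \<subseteq> players n - {l, j}" if "i \<in> S" "l \<notin> S" "insert l (S - {i}) \<in> A"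
        using AB(3,4)[of "insert l (S - {i})"] that N dist by auto
      then show ?thesis using False AB(3,4)[of S] DB[of S] by blast
    qed
    moreover have "(i \<in> S \<and> l \<notin> S \<and> insert l (S - {i}) \<in> A) \<longleftrightarrow>
        S \<in> (\<lambda>S. insert i (S - {l})) ` {S \<in> A. l \<in> S}" for S
      using relabel_image_iff[of "{S \<in> A. l \<in> S}" l i S] AB dist by blast
    ultimately show ?thesis unfolding ow[OF dist(3) N(2)] by auto
  qed
  moreover have "only_wins n (game_of n F) j l = {S \<in> B. l \<notin> S} \<union> (\<lambda>S. insert i (S - {l})) ` L"
  proof -
    have "S \<subseteq> players n - {j, l} \<and> insert j S \<in> F \<longleftrightarrow>
        (S \<in> B \<and> l \<notin> S) \<or> (i \<in> S \<and> l \<notin> S \<and> insert l (S - {i}) \<in> L)" for S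
    proof (cases "S \<subseteq> players n - {j, l}")
      case True
      then have *: "insert j S - {j} = S" "insert j S - {i, j} = S - {i}" "l \<notin> insert j S"
          "i \<in> insert j S \<longleftrightarrow> i \<in> S" "insert j S \<subseteq> players n" "l \<notin> S"
        using dist N by auto
      then show ?thesis using True AB(2) unfolding F_def by auto
    next
      case False
      have "S \<subseteq> players n - {j, l}" if "i \<in> S" "l \<notin> S" "insert l (S - {i}) \<in> L"
        using AB(3,4)[of "insert l (S - {i})"] LB(1)[OF that(3)] that N dist by auto
      then show ?thesis using False AB(3,4)[of S] by blast
    qed
    moreover have "(i \<in> S \<and> l \<notin> S \<and> insert l (S - {i}) \<in> L) \<longleftrightarrow>
        S \<in> (\<lambda>S. insert i (S - {l})) ` L" for S
      using relabel_image_iff[of L l i S] LB AB dist by blast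
    ultimately show ?thesis unfolding ow[OF dist(3)[symmetric] N(3)] by auto
  qed
  moreover have "game_of n F \<in> simple_games n"
    using N(1) by (intro game_of_simple) (auto simp: F_def)
  ultimately show ?thesis using that by blast
qed

subsection \<open>Consequences of the axioms\<close>

text \<open>The bijection in AMWC may move the sets attached to \<open>j\<close> freely inside each
  level, so only the sizes of those levels matter, whereas the family attached to \<open>i\<close>
  enters as it stands.\<close>

lemma AMWC_only_wins:
  assumes "AMWC n R" "i \<in> players n" "j \<in> players n" "v \<in> simple_games n" "w \<in> simple_games n"
    "only_wins n v i j = only_wins n w i j"
    "\<And>k. level_card (only_wins n v j i) k = level_card (only_wins n w j i) k"
  shows "(i, j) \<in> R v \<longleftrightarrow> (i, j) \<in> R w"
proof -
  let ?X = "Pow (players n - {i, j})"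
  have sub: "only_wins n u j i \<subseteq> ?X" for u
    using only_wins_subset[of n u j i] by (simp add: insert_commute)
  obtain p where p: "bij_betw p ?X ?X" "\<And>S. S \<in> ?X \<Longrightarrow> card (p S) = card S"
    "\<And>S. S \<in> ?X \<Longrightarrow> p S \<in> only_wins n w j i \<longleftrightarrow> S \<in> only_wins n v j i"
    by (rule bij_betw_level_preserving[OF _ sub[of v] sub[of w] assms(7)]) (simp, rule that)
  have "(S \<union> {i} \<in> min_winning n v \<longleftrightarrow> S \<union> {i} \<in> min_winning n w) \<and>
      (S \<union> {j} \<in> min_winning n v \<longleftrightarrow> p S \<union> {j} \<in> min_winning n w)" if S: "S \<in> ?X" for S
  proof -
    have pS: "p S \<in> ?X" using bij_betwE[OF p(1)] S by blast
    have i: "S \<union> {i} \<in> min_winning n u \<longleftrightarrow> S \<in> only_wins n u i j" for u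
      using S unfolding only_wins_def by simp
    have j: "T \<union> {j} \<in> min_winning n u \<longleftrightarrow> T \<in> only_wins n u j i" if "T \<in> ?X" for T u
      using that unfolding only_wins_def by (simp add: insert_commute)
    show ?thesis using i j[OF S] j[OF pS] p(3)[OF S] assms(6) by simp
  qed
  then have "\<forall>S\<in>?X. (S \<union> {i} \<in> min_winning n v \<longleftrightarrow> S \<union> {i} \<in> min_winning n w) \<and>
      (S \<union> {j} \<in> min_winning n v \<longleftrightarrow> p S \<union> {j} \<in> min_winning n w)" by blast
  moreover have "\<forall>S\<in>?X. card (p S) = card S" using p(2) by blast
  ultimately show ?thesis
    using assms(1)[unfolded AMWC_def, rule_format, OF assms(2-5) p(1)] by blast
qed

lemma weakly_preferred_of_level_card_le:
  assumes R: "DM n R" "AMWC n R" and N: "i \<in> players n" "j \<in> players n" "i \<noteq> j"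
    and v: "v \<in> simple_games n"
    and le: "\<And>k. level_card (only_wins n v j i) k \<le> level_card (only_wins n v i j) k"
  shows "(i, j) \<in> R v"
proof -
  obtain B where B: "B \<subseteq> only_wins n v i j" "\<And>k. level_card B k = level_card (only_wins n v j i) k"
    using subset_with_level_cards[OF finite_only_wins le] by blast
  obtain w where w: "w \<in> simple_games n" "only_wins n w i j = only_wins n v i j" "only_wins n w j i = B"
    by (rule game_with_only_wins[OF N only_wins_subset only_wins_antichain
          order_trans[OF B(1) only_wins_subset] antichain_subset[OF only_wins_antichain B(1)]])
      (rule that)
  have "(i, j) \<in> R w"
  proof (cases "B = only_wins n v i j")
    case True
    then have "equally_desirable n w i j"
      using w N by (intro equally_desirable_of_only_wins_eq) auto
    then show ?thesis using R(1) N w(1) unfolding DM_def sym_part_def by blast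
  next
    case False
    then have "only_wins n w j i \<subset> only_wins n w i j" using w B(1) by blast
    then have "strictly_desirable n w i j"
      by (rule strictly_desirable_of_only_wins_psubset[OF w(1) N(1)])
    then show ?thesis using R(1) N w(1) unfolding DM_def asym_part_def by blast
  qed
  then show ?thesis using AMWC_only_wins[OF R(2) N(1,2) v w(1)] w(2,3) B(2) by simp
qed

text \<open>AMWC is used for the pair in the order \<open>j, i\<close>, so \<open>B\<close> stays
  fixed and only \<open>A\<close> may be rearranged. The induction generalises over players and game
  because its hypothesis is applied to \<open>i\<close> and \<open>l\<close> in another
  game.\<close>

lemma not_preferred_of_level_card_less_top:
  assumes R: "R \<in> solutions n" "DM n R" "AMWC n R"
    and N: "i \<in> players n" "j \<in> players n" "i \<noteq> j" and v: "v \<in> simple_games n"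
    and low: "\<And>t. t < k \<Longrightarrow> level_card (only_wins n v i j) t = level_card (only_wins n v j i) t"
    and less: "level_card (only_wins n v j i) k < level_card (only_wins n v i j) k"
    and top: "\<And>t. k < t \<Longrightarrow> level_card (only_wins n v i j) t = 0"
      "\<And>t. k < t \<Longrightarrow> level_card (only_wins n v j i) t = 0"
  shows "(j, i) \<notin> R v"
  using N v low less top
proof (induction "\<Sum>t<k. level_card (only_wins n v j i) t" arbitrary: i j v rule: less_induct)
  case (less i j v)
  note N = less.prems(1-3) and v = less.prems(4)
  define X A B where "X = players n - {i, j}" and "A = only_wins n v i j" and "B = only_wins n v j i"
  note low = less.prems(5)[folded A_def B_def] and gt = less.prems(6)[folded A_def B_def]
    and top = less.prems(7,8)[folded A_def B_def]
  have X: "finite X" "A \<subseteq> Pow X" "B \<subseteq> Pow X"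
    using only_wins_subset[of n v i j] only_wins_subset[of n v j i]
    by (simp_all add: X_def A_def B_def insert_commute)
  have fin: "finite A" "finite B" unfolding A_def B_def by (rule finite_only_wins)+
  have anti: "antichain A" "antichain B" unfolding A_def B_def by (rule only_wins_antichain)+
  have posA: "0 < level_card A t \<longleftrightarrow> (\<exists>S\<in>A. card S = t)" for t
    by (rule level_card_pos_iff[OF fin(1)])
  have posB: "0 < level_card B t \<longleftrightarrow> (\<exists>S\<in>B. card S = t)" for t
    by (rule level_card_pos_iff[OF fin(2)])
  have cardk: "card S \<le> k" if "S \<in> A \<union> B" for S
  proof (rule ccontr)
    assume "\<not> card S \<le> k"
    then have "level_card A (card S) = 0" "level_card B (card S) = 0" using top by auto
    then show False using posA[of "card S"] posB[of "card S"] that by auto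
  qed
  obtain T where T: "T \<in> A" "card T = k" using posA[of k] gt by auto
  have transfer: "(j, i) \<in> R v \<longleftrightarrow> (j, i) \<in> R w"
    if "w \<in> simple_games n" "only_wins n w j i = B"
      "\<And>t. level_card (only_wins n w i j) t = level_card A t" for w
    using AMWC_only_wins[OF R(3) N(2,1) v that(1)] that(2,3) by (simp add: A_def B_def)
  show ?case
  proof (cases "\<exists>S\<in>B. card S < k")
    case False
    \<comment> \<open>Here both families lie on level \<open>k\<close> alone, where every subfamily
      is an antichain. So \<open>B\<close> can be enlarged to a family \<open>C\<close> as large as
      \<open>A\<close>, and DM applies.\<close>
    then have Bk: "B \<subseteq> {S. S \<subseteq> X \<and> card S = k}" using cardk X(3) by fastforce
    have "level_card B t = 0" if "t < k" for t using posB[of t] False that by auto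
    then have "card S = k" if "S \<in> A" for S
      using low[of "card S"] posA[of "card S"] cardk[of S] that by (metis UnI1 le_neq_implies_less less_irrefl)
    then have Ak: "A \<subseteq> {S. S \<subseteq> X \<and> card S = k}" using X(2) by blast
    have finL: "finite {S. S \<subseteq> X \<and> card S = k}" using X(1) by simp
    have cards: "level_card A k = card A" "level_card B k = card B"
      using Ak Bk unfolding level_card_def by (auto intro!: arg_cong[where f = card])
    have le: "card B \<le> card A" "card A \<le> card {S. S \<subseteq> X \<and> card S = k}"
      using gt cards card_mono[OF finL Ak] by auto
    obtain C where C: "B \<subseteq> C" "C \<subseteq> {S. S \<subseteq> X \<and> card S = k}" "card C = card A"
      using exists_subset_between[OF le Bk finL] by blast
    have "antichain C"
      unfolding antichain_def
    proof (intro ballI notI)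
      fix S S' assume S: "S \<in> C" "S' \<in> C" "S \<subset> S'"
      then have "S' \<subseteq> X" "card S = card S'" using C(2) by auto
      moreover from this have "finite S'" using X(1) finite_subset by blast
      ultimately show False using S(3) psubset_card_mono[of S' S] by simp
    qed
    moreover have "C \<subseteq> Pow X" using C(2) by blast
    ultimately obtain w where w: "w \<in> simple_games n" "only_wins n w i j = C" "only_wins n w j i = B"
      using game_with_only_wins[OF N, of C B] X(3) anti(2) unfolding X_def by blast
    have "B \<noteq> C" using C(3) gt cards by auto
    then have "only_wins n w j i \<subset> only_wins n w i j" using w C(1) by blast
    then have "strictly_desirable n w i j"
      by (rule strictly_desirable_of_only_wins_psubset[OF w(1) N(1)])
    then have "(j, i) \<notin> R w" using R(2) N w(1) unfolding DM_def asym_part_def by blast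
    moreover have "level_card C t = level_card A t" for t
    proof -
      have "{S \<in> C. card S = t} = (if t = k then C else {})" "{S \<in> A. card S = t} = (if t = k then A else {})"
        using C(2) Ak by auto
      then show ?thesis using C(3) unfolding level_card_def by simp
    qed
    ultimately show ?thesis using transfer[OF w(1,3)] w(2) by simp
  next
    case True
    \<comment> \<open>\<open>t0\<close> is the lowest level of \<open>B\<close> and, since the
      families agree in size below \<open>k\<close>, of \<open>A\<close> too.\<close>
    define t0 where "t0 = (LEAST t. \<exists>S\<in>B. card S = t)"
    obtain S where S: "S \<in> B" "card S = t0"
      using LeastI_ex[of "\<lambda>t. \<exists>S\<in>B. card S = t"] True unfolding t0_def by blast
    have B0: "t0 \<le> card Q" if "Q \<in> B" for Q unfolding t0_def using that by (intro Least_le) blast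
    have t0k: "t0 < k" using True B0 by fastforce
    have A0: "t0 \<le> card Q" if "Q \<in> A" for Q
    proof (rule ccontr)
      assume "\<not> t0 \<le> card Q"
      moreover have "0 < level_card A (card Q)" using posA that by blast
      ultimately have "0 < level_card B (card Q)" using low[of "card Q"] t0k by simp
      then show False using posB[of "card Q"] B0 \<open>\<not> t0 \<le> card Q\<close> by metis
    qed
    have A0ex: "\<exists>S\<in>A. card S = t0" using posA[of t0] posB[of t0] low[OF t0k] S by auto
    \<comment> \<open>If \<open>B\<close> contained all sets of size \<open>t0\<close>, then so would \<open>A\<close>, leaving no room for \<open>T\<close>.\<close>
    obtain S' where S': "S' \<subseteq> X" "card S' = t0" "S' \<notin> B"
    proof (rule ccontr)
      assume "\<not> thesis"
      then have "\<And>S'. S' \<subseteq> X \<Longrightarrow> card S' = t0 \<Longrightarrow> S' \<in> B" using that by blast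
      then have "{Q \<in> B. card Q = t0} = {Q. Q \<subseteq> X \<and> card Q = t0}" using X(3) by blast
      then have "card {Q \<in> A. card Q = t0} = card {Q. Q \<subseteq> X \<and> card Q = t0}"
        using low[OF t0k] unfolding level_card_def by simp
      then have all: "{Q \<in> A. card Q = t0} = {Q. Q \<subseteq> X \<and> card Q = t0}"
        using X(1,2) by (intro card_subset_eq) auto
      obtain Q where Q: "Q \<subseteq> T" "card Q = t0"
        using t0k T(2) obtain_subset_with_card_n[of t0 T] by (metis less_imp_le)
      then have "Q \<in> A" using all T(1) X(2) by blast
      then have "Q = T" using antichain_eq[OF anti(1) _ T(1) Q(1)] by blast
      then show False using Q(2) T(2) t0k by simp
    qed
    \<comment> \<open>This choice serves both alternatives of \<open>star\<close>:
      \<open>S \<in> B\<close> avoids \<open>l\<close>, and \<open>S' \<notin> B\<close> contains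
      it.\<close>
    obtain l where l: "l \<in> S'" "l \<notin> S"
    proof -
      have "finite S" using S(1) X by (auto intro: finite_subset)
      then have "\<not> S' \<subseteq> S" using card_subset_eq[of S S'] S S' by auto
      then show thesis using that by blast
    qed
    then have lX: "l \<in> X" using S'(1) by blast
    then have lN: "l \<in> players n" "l \<noteq> i" "l \<noteq> j" unfolding X_def by auto
    have Tex: "\<exists>S\<in>A. card S = k" using T by blast
    obtain A' s where A': "A' \<subseteq> Pow X" "antichain A'" "\<And>m. level_card A' m = level_card A m"
      and s: "\<And>S. S \<in> A' \<Longrightarrow> l \<in> S \<Longrightarrow> card S \<le> s" "\<And>S. S \<in> A' \<Longrightarrow> l \<notin> S \<Longrightarrow> s \<le> card S"
      and star: "(\<forall>S\<in>A'. card S = t0 \<longrightarrow> l \<in> S) \<or> (\<forall>S\<subseteq>X. card S = t0 \<longrightarrow> l \<in> S \<longrightarrow> S \<in> A')"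
      and free: "\<exists>S\<in>A'. card S = k \<and> l \<notin> S"
      by (rule antichain_split_top[OF X(1,2) anti(1) lX A0 A0ex t0k cardk[OF UnI1] Tex])
        (assumption, assumption, rule that)
    have finA': "finite A'" using finite_subset[OF A'(1)] X(1) by simp
    define ai al bj bl where
      "ai = level_card {S \<in> A'. l \<notin> S}" and "al = level_card {S \<in> A'. l \<in> S}" and
      "bj = level_card {S \<in> B. l \<notin> S}" and "bl = level_card {S \<in> B. l \<in> S}"
    have sumA: "level_card A t = ai t + al t" for t
      using level_card_split[OF finA', of t l] A'(3)[of t] by (simp add: ai_def al_def)
    have sumB: "level_card B t = bj t + bl t" for t
      using level_card_split[OF fin(2), of t l] by (simp add: bj_def bl_def)
    have eq: "ai t + al t = bj t + bl t" if "t \<noteq> k" for t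
      using that low[of t] top[of t] sumA[of t] sumB[of t] by (cases t k rule: linorder_cases) auto
    have gtk: "bj k + bl k < ai k + al k" using gt sumA sumB by simp
    \<comment> \<open>Positivity makes the truncated subtraction \<open>ai k - 1\<close> a true
      decrease.\<close>
    have aik: "0 < ai k"
      using free level_card_pos_iff[of "{S \<in> A'. l \<notin> S}" k] finA' unfolding ai_def by auto
    \<comment> \<open>In the first alternative \<open>ai t0\<close> vanishes, while \<open>S\<close>
      is counted by \<open>bj t0\<close>. In the second, \<open>S'\<close> shows that
      \<open>A'\<close> has more sets through \<open>l\<close> than \<open>B\<close> on this level;
      as the totals agree, it has fewer avoiding \<open>l\<close>.\<close>
    have ai0: "ai t0 < bj t0"
      using star
    proof
      assume "\<forall>S\<in>A'. card S = t0 \<longrightarrow> l \<in> S"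
      then have "ai t0 = 0"
        using level_card_pos_iff[of "{S \<in> A'. l \<notin> S}" t0] finA' unfolding ai_def by auto
      moreover have "0 < bj t0"
        using level_card_pos_iff[of "{S \<in> B. l \<notin> S}" t0] fin(2) S l(2) unfolding bj_def by auto
      ultimately show ?thesis by simp
    next
      assume all: "\<forall>S\<subseteq>X. card S = t0 \<longrightarrow> l \<in> S \<longrightarrow> S \<in> A'"
      have "bl t0 < al t0"
        unfolding bl_def al_def level_card_def
      proof (rule psubset_card_mono)
        show "{S \<in> {S \<in> B. l \<in> S}. card S = t0} \<subset> {S \<in> {S \<in> A'. l \<in> S}. card S = t0}"
          using all X(3) S' l(1) by blast
      qed (use finA' in simp)
      then show ?thesis using eq[of t0] t0k by simp
    qed
    \<comment> \<open>The minima make the level sizes satisfy \<open>i \<ge> l \<ge> j\<close>. The \<open>- 1\<close> makes the first inequality strict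
      at level \<open>k\<close>, and \<open>ai t0 < bj t0\<close> makes the induction measure drop.\<close>
    define d where "d t = (if t = k then min (ai t - 1) (bj t) else min (ai t) (bj t))" for t
    define e where "e t = min (al t) (bl t)" for t
    have finB: "finite {S \<in> B. l \<notin> S}" "finite {S \<in> B. l \<in> S}" using fin(2) by simp_all
    have de: "d t \<le> bj t" "e t \<le> bl t" for t unfolding d_def e_def by simp_all
    obtain D where D: "D \<subseteq> {S \<in> B. l \<notin> S}" "\<And>t. level_card D t = d t"
      using subset_with_level_cards[OF finB(1) de(1)[unfolded bj_def]] by blast
    obtain L where L: "L \<subseteq> {S \<in> B. l \<in> S}" "\<And>t. level_card L t = e t"
      using subset_with_level_cards[OF finB(2) de(2)[unfolded bl_def]] by blast
    have finDL: "finite D" "finite L" using D(1) L(1) finB finite_subset by blast+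
    \<comment> \<open>Where \<open>d\<close> is positive, \<open>A'\<close> has a set of that size
      avoiding \<open>l\<close>, so the bound for \<open>A'\<close> passes to \<open>D\<close>;
      \<open>e\<close> plays the same part for \<open>L\<close>.\<close>
    have Ds: "s \<le> card Q" if "Q \<in> D" for Q
    proof -
      have "0 < d (card Q)" using level_card_pos_iff[OF finDL(1)] D(2) that by auto
      then have "0 < ai (card Q)" unfolding d_def by (auto split: if_splits)
      then obtain S where "S \<in> A'" "l \<notin> S" "card S = card Q"
        using level_card_pos_iff[of "{S \<in> A'. l \<notin> S}" "card Q"] finA' unfolding ai_def by auto
      then show ?thesis using s(2)[of S] by simp
    qed
    have Ls: "card Q \<le> s" if "Q \<in> L" for Q
    proof -
      have "0 < e (card Q)" using level_card_pos_iff[OF finDL(2)] L(2) that by auto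
      then have "0 < al (card Q)" unfolding e_def by simp
      then obtain S where "S \<in> A'" "l \<in> S" "card S = card Q"
        using level_card_pos_iff[of "{S \<in> A'. l \<in> S}" "card Q"] finA' unfolding al_def by auto
      then show ?thesis using s(1)[of S] by simp
    qed
    obtain w where w: "w \<in> simple_games n" "only_wins n w i j = A'" "only_wins n w j i = B"
      "only_wins n w i l = {S \<in> A'. l \<notin> S} \<union> (\<lambda>S. insert j (S - {l})) ` L"
      "only_wins n w l i = D \<union> (\<lambda>S. insert j (S - {l})) ` {S \<in> B. l \<in> S}"
      "only_wins n w l j = D \<union> (\<lambda>S. insert i (S - {l})) ` {S \<in> A'. l \<in> S}"
      "only_wins n w j l = {S \<in> B. l \<notin> S} \<union> (\<lambda>S. insert i (S - {l})) ` L"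
      by (rule mediating_game[OF N(1,2) lN(1) N(3) lN(2,3) A'(1)[unfolded X_def] A'(2)
            X(3)[unfolded X_def] anti(2) s D(1) Ds L(1) Ls]) (assumption | rule that)+
    have AB: "finite Q" "i \<notin> Q" "j \<notin> Q" if "Q \<in> A' \<or> Q \<in> B" for Q
    proof -
      have "Q \<subseteq> X" using that A'(1) X(3) by blast
      moreover from this have "finite Q" using X(1) finite_subset by blast
      ultimately show "finite Q" "i \<notin> Q" "j \<notin> Q" unfolding X_def by auto
    qed
    have il: "level_card (only_wins n w i l) t = ai t + e t" for t
      unfolding w(4) ai_def L(2)[symmetric]
      by (rule level_card_relabel) (use finA' finDL L(1) AB in auto)
    have li: "level_card (only_wins n w l i) t = d t + bl t" for t
      unfolding w(5) bl_def D(2)[symmetric]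
      by (rule level_card_relabel) (use fin finDL D(1) AB in auto)
    have lj: "level_card (only_wins n w l j) t = d t + al t" for t
      unfolding w(6) al_def D(2)[symmetric]
      by (rule level_card_relabel) (use finA' finDL D(1) AB in auto)
    have jl: "level_card (only_wins n w j l) t = bj t + e t" for t
      unfolding w(7) bj_def L(2)[symmetric]
      by (rule level_card_relabel) (use fin finDL L(1) AB in auto)
    have eq_il: "ai t + e t = d t + bl t" if "t \<noteq> k" for t
      using eq[OF that] that unfolding d_def e_def by (simp add: min_def)
    have gt_il: "d k + bl k < ai k + e k"
      using gtk aik unfolding d_def e_def by (simp add: min_def) arith
    have ge_lj: "bj t + e t \<le> d t + al t" for t
      using eq[of t] gtk aik unfolding d_def e_def by (cases "t = k") (simp_all add: min_def, arith+)
    have "(l, j) \<in> R w"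
      using weakly_preferred_of_level_card_le[OF R(2,3) lN(1) N(2) lN(3) w(1)] ge_lj
      by (simp add: lj jl)
    moreover have "(l, i) \<notin> R w"
    proof (rule less.hyps)
      show "(\<Sum>t<k. level_card (only_wins n w l i) t) < (\<Sum>t<k. level_card (only_wins n v j i) t)"
      proof (rule sum_strict_mono_ex1)
        show "\<forall>t\<in>{..<k}. level_card (only_wins n w l i) t \<le> level_card (only_wins n v j i) t"
          unfolding li B_def[symmetric] sumB d_def by auto
        show "\<exists>t\<in>{..<k}. level_card (only_wins n w l i) t < level_card (only_wins n v j i) t"
          unfolding li B_def[symmetric] sumB d_def using ai0 t0k by (intro bexI[of _ t0]) auto
      qed simp
      show "level_card (only_wins n w i l) t = level_card (only_wins n w l i) t" if "t < k" for t
        using eq_il that by (simp add: il li)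
      show "level_card (only_wins n w l i) k < level_card (only_wins n w i l) k"
        using gt_il by (simp add: il li)
      have zero: "ai t = 0 \<and> al t = 0 \<and> bj t = 0 \<and> bl t = 0" if "k < t" for t
        using top[OF that] sumA[of t] sumB[of t] by simp
      show "level_card (only_wins n w i l) t = 0" if "k < t" for t
        using zero[OF that] by (simp add: il e_def)
      show "level_card (only_wins n w l i) t = 0" if "k < t" for t
        using zero[OF that] that by (simp add: li d_def)
    qed (use N lN w(1) in auto)
    moreover have "trans (R w)"
      using R(1) w(1) unfolding solutions_def total_preorders_def preorder_on_def
      by (auto dest: PiE_mem)
    ultimately have "(j, i) \<notin> R w" by (meson transD)
    then show ?thesis using transfer[OF w(1,3)] w(2) A'(3) by simp
  qed
qed

subsection \<open>LRM satisfies the axioms\<close>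

lemma lex_ge_refl: "lex_ge n x x"
  unfolding lex_ge_def by simp

lemma lex_ge_total: "lex_ge n x y \<or> lex_ge n y x"
proof (cases "\<forall>t\<in>{1..n}. x t = y t")
  case False
  define k where "k = (LEAST t. t \<in> {1..n} \<and> x t \<noteq> y t)"
  have k: "k \<in> {1..n} \<and> x k \<noteq> y k" unfolding k_def by (rule LeastI_ex) (use False in blast)
  have "x t = y t" if "t \<in> {1..<k}" for t
  proof -
    have "t < k" "t \<in> {1..n}" using that k by auto
    then show ?thesis using not_less_Least[of t "\<lambda>t. t \<in> {1..n} \<and> x t \<noteq> y t"] unfolding k_def by blast
  qed
  then show ?thesis using k unfolding lex_ge_def by (metis linorder_neqE)
qed (simp add: lex_ge_def)

lemma lex_ge_trans:
  assumes "lex_ge n x y" "lex_ge n y z"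
  shows "lex_ge n x z"
proof (cases "(\<forall>t\<in>{1..n}. x t = y t) \<or> (\<forall>t\<in>{1..n}. y t = z t)")
  case True
  then consider "\<And>t. t \<in> {1..n} \<Longrightarrow> x t = y t" | "\<And>t. t \<in> {1..n} \<Longrightarrow> y t = z t" by blast
  then show ?thesis
  proof cases
    case 1
    then show ?thesis using assms(2) unfolding lex_ge_def by (simp cong: conj_cong)
  next
    case 2
    then show ?thesis using assms(1) unfolding lex_ge_def by (simp cong: conj_cong)
  qed
next
  case False
  then obtain k m where k: "k \<in> {1..n}" "\<forall>t\<in>{1..<k}. x t = y t" "y k < x k"
    and m: "m \<in> {1..n}" "\<forall>t\<in>{1..<m}. y t = z t" "z m < y m"
    using assms unfolding lex_ge_def by blast
  \<comment> \<open>The earlier of the two first differences decides.\<close>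
  have "\<forall>t\<in>{1..<min k m}. x t = z t" using k(2) m(2) by simp
  moreover have "z (min k m) < x (min k m)"
    using k m by (cases k m rule: linorder_cases) (auto simp: min_def)
  moreover have "min k m \<in> {1..n}" using k(1) m(1) by (auto simp: min_def)
  ultimately show ?thesis unfolding lex_ge_def by blast
qed

lemma LRM_in_solutions: "LRM n \<in> solutions n"
proof -
  have "{(i, j). i \<in> players n \<and> j \<in> players n \<and> lex_ge n (theta n v i) (theta n v j)}
      \<in> total_preorders n" for v
    using lex_ge_refl lex_ge_total lex_ge_trans
    unfolding total_preorders_def preorder_on_def refl_on_def total_on_def trans_def by blast
  then show ?thesis unfolding solutions_def LRM_def by (intro PiE_I) auto
qed

section \<open>Strict lexicographic comparison of level sizes\<close>

text \<open>The index is unbounded, which agrees with LRM because the levels of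
  \<open>only_wins\<close> from \<open>n\<close> on are empty.\<close>

definition lex_greater :: "(nat \<Rightarrow> nat) \<Rightarrow> (nat \<Rightarrow> nat) \<Rightarrow> bool" where
  "lex_greater a b \<longleftrightarrow> (\<exists>k. (\<forall>t<k. a t = b t) \<and> b k < a k)"

lemma lex_greater_cases:
  obtains "a = b" | "lex_greater a b" | "lex_greater b a"
proof (cases "a = b")
  case False
  define k where "k = (LEAST t. a t \<noteq> b t)"
  have "a k \<noteq> b k" unfolding k_def by (rule LeastI_ex) (use False in blast)
  moreover have "\<forall>t<k. a t = b t" unfolding k_def using not_less_Least by blast
  ultimately have "lex_greater a b \<or> lex_greater b a"
    unfolding lex_greater_def by (metis linorder_neqE)
  then show ?thesis using that by blast
qed (rule that)

lemma lex_greater_asym: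
  assumes "lex_greater a b"
  shows "\<not> lex_greater b a" "a \<noteq> b"
proof -
  obtain k where k: "\<forall>t<k. a t = b t" "b k < a k" using assms unfolding lex_greater_def by blast
  show "a \<noteq> b" using k(2) by auto
  show "\<not> lex_greater b a"
  proof
    assume "lex_greater b a"
    then obtain m where "\<forall>t<m. b t = a t" "a m < b m" unfolding lex_greater_def by blast
    then show False using k by (cases k m rule: linorder_cases) auto
  qed
qed

lemma LRM_iff:
  assumes "i \<in> players n" "j \<in> players n" "i \<noteq> j" "v \<in> simple_games n"
  shows "(i, j) \<in> LRM n v \<longleftrightarrow>
    \<not> lex_greater (level_card (only_wins n v j i)) (level_card (only_wins n v i j))"
proof -
  have "(i, j) \<in> LRM n v \<longleftrightarrow>
      level_card (only_wins n v i j) = level_card (only_wins n v j i) \<or>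
      lex_greater (level_card (only_wins n v i j)) (level_card (only_wins n v j i))"
    using assms lex_ge_theta_iff[OF assms(3,1,2), of v]
    unfolding LRM_def lex_greater_def fun_eq_iff by simp
  also have "\<dots> \<longleftrightarrow> \<not> lex_greater (level_card (only_wins n v j i)) (level_card (only_wins n v i j))"
    using lex_greater_cases lex_greater_asym by metis
  finally show ?thesis .
qed

lemma LRM_asym_part_iff:
  assumes "i \<in> players n" "j \<in> players n" "i \<noteq> j" "v \<in> simple_games n"
  shows "(i, j) \<in> asym_part (LRM n v) \<longleftrightarrow>
    lex_greater (level_card (only_wins n v i j)) (level_card (only_wins n v j i))"
  using LRM_iff[OF assms] LRM_iff[OF assms(2,1) assms(3)[symmetric] assms(4)] lex_greater_asym
  unfolding asym_part_def by blast

section \<open>The two antichains determined from desirability\<close>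

text \<open>Desirability makes \<open>S \<union> {i}\<close> winning, and a minimal winning
  \<open>Q\<close> inside it must contain \<open>i\<close>, or it would lie properly inside
  \<open>S \<union> {j}\<close>. If \<open>Q - {i}\<close> were a proper subset of \<open>S\<close>,
  then \<open>smaller\<close> would put both into one antichain. In the applications
  \<open>smaller\<close> comes from induction over subsets or from a minimal choice.\<close>

lemma only_wins_of_desirable:
  assumes N: "i \<in> players n" "j \<in> players n" "i \<noteq> j"
    and des: "desirable n v i j" and S: "S \<in> only_wins n v j i"
    and smaller: "\<And>T. T \<subset> S \<Longrightarrow> T \<in> only_wins n v i j \<Longrightarrow> T \<in> only_wins n v j i"
  shows "S \<in> only_wins n v i j"
proof -
  have Sij: "S \<subseteq> players n - {i, j}" "insert j S \<in> min_winning n v"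
    using S unfolding only_wins_def by auto
  have "S \<union> {j} \<in> winning n v" using min_winning_imp_winning[OF Sij(2)] by simp
  then have "insert i S \<in> winning n v" using des Sij(1) unfolding desirable_def by simp
  then obtain Q where Q: "Q \<in> min_winning n v" "Q \<subseteq> insert i S"
    using winning_imp_min_winning by blast
  have iQ: "i \<in> Q"
  proof (rule ccontr)
    assume "i \<notin> Q"
    then have "Q \<subseteq> insert j S" using Q(2) by blast
    then have "Q = insert j S" using antichain_eq[OF min_winning_antichain Q(1) Sij(2)] by blast
    then show False using \<open>i \<notin> Q\<close> Q(2) Sij(1) N(3) by blast
  qed
  define T where "T = Q - {i}"
  have T: "insert i T = Q" "T \<subseteq> S" "T \<subseteq> players n - {i, j}"
    using iQ Q(2) Sij(1) unfolding T_def by auto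
  then have Tij: "T \<in> only_wins n v i j" using Q(1) unfolding only_wins_def by simp
  have "T = S"
  proof (rule ccontr)
    assume "T \<noteq> S"
    then have "T \<in> only_wins n v j i" using smaller Tij T(2) by blast
    then show False using antichain_eq[OF only_wins_antichain _ S T(2)] \<open>T \<noteq> S\<close> by blast
  qed
  then show ?thesis using Tij by simp
qed

text \<open>Both inclusions are proved in one induction over proper subsets, since each provides
  \<open>smaller\<close> for the other.\<close>

lemma only_wins_eq_of_equally_desirable:
  assumes N: "i \<in> players n" "j \<in> players n" "i \<noteq> j" and eq: "equally_desirable n v i j"
  shows "only_wins n v i j = only_wins n v j i"
proof -
  have des: "desirable n v i j" "desirable n v j i" using eq unfolding equally_desirable_def by auto
  have "S \<in> only_wins n v i j \<longleftrightarrow> S \<in> only_wins n v j i" if "finite S" for S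
    using that
  proof (induction S rule: finite_psubset_induct)
    case (psubset S)
    then show ?case
      using only_wins_of_desirable[OF N des(1)]
        only_wins_of_desirable[OF N(2,1) N(3)[symmetric] des(2)] by blast
  qed
  moreover have "finite S" if "S \<in> only_wins n v i j \<or> S \<in> only_wins n v j i" for S
    using that only_wins_subset[of n v i j] only_wins_subset[of n v j i]
    by (meson PowD finite_Diff finite_atLeastAtMost finite_subset subsetD)
  ultimately show ?thesis by blast
qed

text \<open>The deciding level is the size of a smallest \<open>S\<close> that belongs to the family
  of \<open>i\<close> but not to that of \<open>j\<close>: below it the families coincide, and on it
  the family of \<open>j\<close> is properly contained in the other.\<close>

lemma lex_greater_of_strictly_desirable:
  assumes N: "i \<in> players n" "j \<in> players n" "i \<noteq> j" and v: "v \<in> simple_games n"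
    and str: "strictly_desirable n v i j"
  shows "lex_greater (level_card (only_wins n v i j)) (level_card (only_wins n v j i))"
proof -
  let ?A = "only_wins n v i j" and ?B = "only_wins n v j i"
  have des: "desirable n v i j" using str unfolding strictly_desirable_def by simp
  obtain S0 where S0: "S0 \<in> ?A \<and> S0 \<notin> ?B"
  proof (rule ccontr)
    \<comment> \<open>Otherwise the family of \<open>i\<close> lies in that of \<open>j\<close>, so
      \<open>j\<close> is at least as desirable as \<open>i\<close>, contrary to
      \<open>str\<close>.\<close>
    assume "\<not> thesis"
    then have none: "\<nexists>S. S \<in> ?A \<and> S \<notin> ?B" using that by blast
    then have "desirable n v j i" by (intro desirable_of_only_wins_subset[OF v N(2)]) blast
    then show False using str unfolding strictly_desirable_def desirable_def
      by (metis insert_commute)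
  qed
  obtain S where S: "S \<in> ?A" "S \<notin> ?B" "\<And>T. T \<in> ?A \<Longrightarrow> T \<notin> ?B \<Longrightarrow> card S \<le> card T"
    using ex_has_least_nat[of "\<lambda>S. S \<in> ?A \<and> S \<notin> ?B", OF S0, of card] by blast
  have BA: "T \<in> ?A" if T: "T \<in> ?B" "card T \<le> card S" for T
  proof (rule only_wins_of_desirable[OF N des T(1)])
    have "T \<subseteq> players n" using T(1) only_wins_subset by blast
    then have "finite T" by (rule finite_subset) simp
    then show "Q \<in> ?B" if "Q \<subset> T" "Q \<in> ?A" for Q
      using S(3)[OF that(2)] psubset_card_mono[OF _ that(1)] T(2) by fastforce
  qed
  have "level_card ?A t = level_card ?B t" if "t < card S" for t
  proof -
    have "{T \<in> ?A. card T = t} = {T \<in> ?B. card T = t}" using BA S(3) that by fastforce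
    then show ?thesis unfolding level_card_def by simp
  qed
  moreover have "level_card ?B (card S) < level_card ?A (card S)"
    unfolding level_card_def
  proof (rule psubset_card_mono)
    show "{T \<in> ?B. card T = card S} \<subset> {T \<in> ?A. card T = card S}" using BA S(1,2) by fastforce
  qed (use finite_only_wins in simp)
  ultimately show ?thesis unfolding lex_greater_def by blast
qed

lemma LRM_refl: "i \<in> players n \<Longrightarrow> v \<in> simple_games n \<Longrightarrow> (i, i) \<in> LRM n v"
  unfolding LRM_def using lex_ge_refl by simp

lemma LRM_DM: "DM n (LRM n)"
  unfolding DM_def
proof (intro ballI conjI impI)
  fix i j v assume N: "i \<in> players n" "j \<in> players n" and v: "v \<in> simple_games n"
  {
    assume eq: "equally_desirable n v i j"
    show "(i, j) \<in> sym_part (LRM n v)"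
    proof (cases "i = j")
      case True
      then show ?thesis using LRM_refl[OF N(1) v] unfolding sym_part_def by simp
    next
      case False
      then show ?thesis
        using only_wins_eq_of_equally_desirable[OF N False eq] LRM_iff[OF N False v]
          LRM_iff[OF N(2,1) False[symmetric] v] lex_greater_asym unfolding sym_part_def by auto
    qed
  next
    assume str: "strictly_desirable n v i j"
    then have ij: "i \<noteq> j" unfolding strictly_desirable_def by blast
    then show "(i, j) \<in> asym_part (LRM n v)"
      using LRM_asym_part_iff[OF N ij v] lex_greater_of_strictly_desirable[OF N ij v str] by simp
  }
qed

text \<open>A size-preserving permutation carrying one family of \<open>j\<close> onto the other
  equates their level sizes, and LRM depends on nothing else in them.\<close>

lemma LRM_AMWC: "AMWC n (LRM n)"
  unfolding AMWC_def
proof (intro ballI allI impI)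
  fix i j v w p
  let ?X = "Pow (players n - {i, j})"
  assume N: "i \<in> players n" "j \<in> players n" and vw: "v \<in> simple_games n" "w \<in> simple_games n"
    and p: "bij_betw p ?X ?X" "\<forall>S\<in>?X. card (p S) = card S"
    and mwc: "\<forall>S\<in>?X. (S \<union> {i} \<in> min_winning n v \<longleftrightarrow> S \<union> {i} \<in> min_winning n w) \<and>
      (S \<union> {j} \<in> min_winning n v \<longleftrightarrow> p S \<union> {j} \<in> min_winning n w)"
  show "(i, j) \<in> LRM n v \<longleftrightarrow> (i, j) \<in> LRM n w"
  proof (cases "i = j")
    case True
    then show ?thesis using LRM_refl N vw by simp
  next
    case False
    have "only_wins n v i j = only_wins n w i j"
      using mwc unfolding only_wins_def by auto
    moreover have "level_card (only_wins n v j i) k = level_card (only_wins n w j i) k" for k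
    proof -
      have sub: "only_wins n u j i \<subseteq> ?X" for u
        using only_wins_subset[of n u j i] by (simp add: insert_commute)
      have in_iff: "S \<in> only_wins n u j i \<longleftrightarrow> S \<union> {j} \<in> min_winning n u" if "S \<in> ?X" for S u
        using that unfolding only_wins_def by (simp add: insert_commute)
      have pX: "p S \<in> ?X" if "S \<in> ?X" for S using bij_betwE[OF p(1)] that by blast
      have iff: "p S \<in> only_wins n w j i \<longleftrightarrow> S \<in> only_wins n v j i" if "S \<in> ?X" for S
        using in_iff[OF that, of v] in_iff[OF pX[OF that], of w] mwc that by blast
      have "p ` only_wins n v j i = only_wins n w j i"
      proof
        show "p ` only_wins n v j i \<subseteq> only_wins n w j i" using iff sub by blast
        show "only_wins n w j i \<subseteq> p ` only_wins n v j i"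
        proof
          fix T assume T: "T \<in> only_wins n w j i"
          then have "T \<in> ?X" using sub[of w] by blast
          then have "T \<in> p ` ?X" using bij_betw_imp_surj_on[OF p(1)] by simp
          then obtain S where "S \<in> ?X" "T = p S" by blast
          then show "T \<in> p ` only_wins n v j i" using iff T by blast
        qed
      qed
      moreover have "inj_on p (only_wins n v j i)"
        using inj_on_subset[OF bij_betw_imp_inj_on[OF p(1)] sub] .
      moreover have "card (p S) = card S" if "S \<in> only_wins n v j i" for S
        using p(2) sub[of v] that by blast
      ultimately show ?thesis using level_card_image[of p "only_wins n v j i" k] by simp
    qed
    ultimately show ?thesis
      using LRM_iff[OF N False vw(1)] LRM_iff[OF N False vw(2)] by presburger
  qed
qed

lemma max_mwc_size_ge:
  assumes "S \<in> min_winning n v" "S \<inter> {i, j} \<noteq> {}"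
  shows "card S \<le> max_mwc_size n v i j"
  unfolding max_mwc_size_def using assms finite_min_winning by (intro Max_ge) auto

lemma card_insert_player:
  assumes "S \<subseteq> players n - {i, j}"
  shows "card (insert i S) = Suc (card S)"
proof -
  have "finite S" using assms by (rule finite_subset) simp
  moreover have "i \<notin> S" using assms by blast
  ultimately show ?thesis by simp
qed

text \<open>The deciding level \<open>k\<close> is occupied by a coalition through \<open>i\<close>
  of size \<open>Suc k\<close>, so \<open>Suc k\<close> is at most
  \<open>max_mwc_size n v i j\<close>. The added coalitions are larger and leave all levels up to
  \<open>k\<close> unchanged.\<close>

lemma LRM_ILMWC: "ILMWC n (LRM n)"
  unfolding ILMWC_def
proof (intro ballI allI impI)
  fix i j v \<S> w
  assume N: "i \<in> players n" "j \<in> players n" and vw: "v \<in> simple_games n" "w \<in> simple_games n"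
    and large: "\<forall>S\<in>\<S>. max_mwc_size n v i j < card S"
    and w: "min_winning n w = min_winning n v \<union> \<S>"
    and P: "(i, j) \<in> asym_part (LRM n v)"
  have ij: "i \<noteq> j" using P unfolding asym_part_def by blast
  obtain k where k: "\<forall>t<k. level_card (only_wins n v i j) t = level_card (only_wins n v j i) t"
    "level_card (only_wins n v j i) k < level_card (only_wins n v i j) k"
    using P LRM_asym_part_iff[OF N ij vw(1)] unfolding lex_greater_def by blast
  obtain S where S: "S \<in> only_wins n v i j" "card S = k"
    using level_card_pos_iff[OF finite_only_wins, of n v i j k] k(2) by auto
  note suc = card_insert_player[of _ n]
  have "Suc k \<le> max_mwc_size n v i j"
    using max_mwc_size_ge[of "insert i S" n v i j] S suc[of S i j] unfolding only_wins_def by auto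
  then have same: "level_card (only_wins n w a b) t = level_card (only_wins n v a b) t"
    if "t \<le> k" for a b t
  proof -
    have "insert a T \<notin> \<S>" if "T \<subseteq> players n - {a, b}" "card T = t" for T
      using large suc[OF that(1)] that(2) \<open>t \<le> k\<close> \<open>Suc k \<le> max_mwc_size n v i j\<close> by fastforce
    then have "{T \<in> only_wins n w a b. card T = t} = {T \<in> only_wins n v a b. card T = t}"
      unfolding only_wins_def w by blast
    then show ?thesis unfolding level_card_def by simp
  qed
  then have "lex_greater (level_card (only_wins n w i j)) (level_card (only_wins n w j i))"
    using k unfolding lex_greater_def by (intro exI[of _ k]) simp
  then show "(i, j) \<in> asym_part (LRM n w)" using LRM_asym_part_iff[OF N ij vw(2)] by simp
qed

subsection \<open>Uniqueness\<close>

text \<open>The game is cut off just above the deciding level, which thereby becomes the top level.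
  Strict preference is established there, and ILMWC carries it back when the larger coalitions are
  restored.\<close>

lemma asym_part_of_lex_greater:
  assumes R: "R \<in> solutions n" "DM n R" "AMWC n R" "ILMWC n R"
    and N: "i \<in> players n" "j \<in> players n" "i \<noteq> j" and v: "v \<in> simple_games n"
    and gt: "lex_greater (level_card (only_wins n v i j)) (level_card (only_wins n v j i))"
  shows "(i, j) \<in> asym_part (R v)"
proof -
  obtain k where k: "\<And>t. t < k \<Longrightarrow> level_card (only_wins n v i j) t = level_card (only_wins n v j i) t"
    "level_card (only_wins n v j i) k < level_card (only_wins n v i j) k"
    using gt unfolding lex_greater_def by blast
  \<comment> \<open>The bound is \<open>Suc k\<close> because level \<open>k\<close> counts sets
    from which the player has been removed.\<close>
  define F where "F = {S \<in> min_winning n v. card S \<le> Suc k}"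
  define w where "w = game_of n F"
  note suc = card_insert_player[of _ n]
  have "F \<noteq> {}"
  proof -
    obtain S where "S \<in> only_wins n v i j" "card S = k"
      using level_card_pos_iff[OF finite_only_wins, of n v i j k] k(2) by auto
    then have "insert i S \<in> F" using suc[of S i j] unfolding F_def only_wins_def by simp
    then show ?thesis by blast
  qed
  moreover have "F \<subseteq> Pow (players n)" unfolding F_def using min_winning_subset[of _ n v] by blast
  moreover have "antichain F"
    using antichain_subset[OF min_winning_antichain, of F n v] unfolding F_def by blast
  ultimately have mw: "min_winning n w = F" unfolding w_def by (intro min_winning_game_of)
  have w: "w \<in> simple_games n"
    unfolding w_def
  proof (rule game_of_simple)
    have "v {} = 0" using v unfolding simple_games_def by simp
    then show "{} \<notin> F" unfolding F_def min_winning_def winning_def by simp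
  qed (use N(1) in blast)
  have lev: "level_card (only_wins n w a b) t = (if t \<le> k then level_card (only_wins n v a b) t else 0)"
    for a b t
  proof -
    have "{T \<in> only_wins n w a b. card T = t} =
        (if t \<le> k then {T \<in> only_wins n v a b. card T = t} else {})"
      unfolding only_wins_def mw F_def using suc[of _ a b] by auto
    then show ?thesis unfolding level_card_def by simp
  qed
  have "(i, j) \<in> R w"
  proof (rule weakly_preferred_of_level_card_le[OF R(2,3) N w])
    show "level_card (only_wins n w j i) t \<le> level_card (only_wins n w i j) t" for t
      using k(1)[of t] k(2) unfolding lev by (cases t k rule: linorder_cases) auto
  qed
  moreover have "(j, i) \<notin> R w"
    by (rule not_preferred_of_level_card_less_top[OF R(1-3) N w, of k]) (use k in \<open>auto simp: lev\<close>)
  ultimately have Pw: "(i, j) \<in> asym_part (R w)" unfolding asym_part_def by simp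
  define \<S> where "\<S> = {S \<in> min_winning n v. Suc k < card S}"
  have "max_mwc_size n w i j \<le> Suc k"
    unfolding max_mwc_size_def mw using finite_min_winning[of n v] by (auto simp: F_def)
  then have "\<forall>S\<in>\<S>. max_mwc_size n w i j < card S" unfolding \<S>_def by auto
  moreover have "\<S> \<subseteq> Pow (players n)" unfolding \<S>_def using min_winning_subset[of _ n v] by blast
  moreover have un: "min_winning n v = min_winning n w \<union> \<S>" unfolding mw F_def \<S>_def by auto
  moreover have "\<forall>S\<in>\<S>. \<not> (\<exists>Q\<in>min_winning n w \<union> \<S>. Q \<subset> S)"
    unfolding un[symmetric] using min_winning_antichain[of n v] unfolding \<S>_def antichain_def by blast
  ultimately show ?thesis
    using R(4)[unfolded ILMWC_def, rule_format, OF N(1,2) w, of \<S> v] v Pw by blast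
qed

lemma LRM_unique:
  assumes R: "R \<in> solutions n" "DM n R" "AMWC n R" "ILMWC n R"
  shows "R = LRM n"
proof (rule PiE_ext)
  show "R \<in> simple_games n \<rightarrow>\<^sub>E total_preorders n" "LRM n \<in> simple_games n \<rightarrow>\<^sub>E total_preorders n"
    using R(1) LRM_in_solutions unfolding solutions_def by auto
  fix v assume v: "v \<in> simple_games n"
  have "R v \<in> total_preorders n" "LRM n v \<in> total_preorders n"
    using R(1) LRM_in_solutions[of n] v unfolding solutions_def by (auto dest: PiE_mem)
  then have sub: "R v \<subseteq> players n \<times> players n" "LRM n v \<subseteq> players n \<times> players n"
    and refl: "\<And>i. i \<in> players n \<Longrightarrow> (i, i) \<in> R v"
    unfolding total_preorders_def preorder_on_def refl_on_def by auto
  have "(i, j) \<in> R v \<longleftrightarrow> (i, j) \<in> LRM n v" if N: "i \<in> players n" "j \<in> players n" for i j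
  proof (cases "i = j")
    case True
    then show ?thesis using refl LRM_refl N v by simp
  next
    case False
    show ?thesis
    proof (cases rule: lex_greater_cases[of "level_card (only_wins n v i j)" "level_card (only_wins n v j i)"])
      case 1
      then have "(i, j) \<in> R v"
        using weakly_preferred_of_level_card_le[OF R(2,3) N False v] by simp
      then show ?thesis using LRM_iff[OF N False v] 1 lex_greater_asym by metis
    next
      case 2
      then have "(i, j) \<in> R v"
        using asym_part_of_lex_greater[OF R N False v] unfolding asym_part_def by simp
      then show ?thesis using LRM_iff[OF N False v] 2 lex_greater_asym by metis
    next
      case 3
      then have "(i, j) \<notin> R v"
        using asym_part_of_lex_greater[OF R N(2,1) False[symmetric] v] unfolding asym_part_def by simp
      then show ?thesis using LRM_iff[OF N False v] 3 by metis
    qed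
  qed
  then show "R v = LRM n v" using sub by blast
qed

theorem theorem1:
  fixes n :: nat
  shows "LRM n \<in> solutions n \<and> DM n (LRM n) \<and> AMWC n (LRM n) \<and> ILMWC n (LRM n) \<and>
    (\<forall>R \<in> solutions n. DM n R \<and> AMWC n R \<and> ILMWC n R \<longrightarrow> R = LRM n)"
  using LRM_in_solutions LRM_DM LRM_AMWC LRM_ILMWC LRM_unique by blast

end
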